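(* Consider the latent variable Gaussian graphical model described in the context, with $n\to\infty$, $p=p_n$, and all of its standing assumptions: $(\Sigma_O^{\ast})^{-1}=S^{\ast}-L^{\ast}$; $S^{\ast}\in\mathcal{U}(s_0(p),M_p)$; $L^{\ast}=\sum_{i=1}^{r_0(p)}\lambda_i u_iu_i^T$ with $\|u_i\|_\infty\le\sqrt{c_0/p}$ for all $i$ and $\|L^{\ast}\|_{1\to1}\le M_p$; $\lambda_{\max}(\Sigma_O^{\ast})\le M$ and $\lambda_{\min}(\Sigma_O^{\ast})\ge 1/M$. Let $\tau_n=C_1M_p\sqrt{(\log p)/n}$, where $C_1$ is a sufficiently large constant (larger than a threshold depending only on $M$), and let $\hat S$ and $\tilde S$ be the estimators defined in the context. Suppose that $$\sqrt{(\log p)/n}=o(1)\quad\text{and}\quad \|L^{\ast}\|_\infty\le M_p\tau_n .$$ Then there is a constant $C_s$ depending only on $M$ such that, for all sufficiently large $n$, with probability greater than $1-C_sp^{-6}$, $$\|\hat S-S^{\ast}\|_\infty\le 9M_p\tau_n .$$ Hence, if the minimum magnitude of the nonzero entries of $S^{\ast}$, $\theta=\min\{|s^{\ast}_{ij}|: s^{\ast}_{ij}\ne0\}$, satisfies $\theta>18M_p\tau_n$, then (with probability greater than $1-C_sp^{-6}$) $\operatorname{sign}(\tilde S)=\operatorname{sign}(S^{\ast})$. In particular, if $M_p$ is bounded by a constant, then $\theta$ of order $\sqrt{(\log p)/n}$ suffices for this: there is a constant $C$ (not depending on $n,p$) such that $\theta> C\sqrt{(\log p)/n}$ implies $\operatorname{sign}(\tilde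 S)=\operatorname{sign}(S^{\ast})$ with probability greater than $1-C_sp^{-6}$.
   Context: Norms: for a matrix $A=(a_{ij})$, $\|A\|_\infty=\max_{i,j}|a_{ij}|$ (entrywise), $\|A\|_1=\sum_{i,j}|a_{ij}|$, and $\|A\|_{1\to1}=\max_{1\le i\le p}\sum_{j}|a_{ij}|$ for symmetric $A$ (the matrix $\ell_1$ operator norm). For a vector $u$, $\|u\|_\infty$ is the max-norm. $A\succ0$ means symmetric positive definite, $A\succeq 0$ nonnegative definite. $\operatorname{sign}(A)$ is the matrix of entrywise signs, in $\{-1,0,1\}$. $\lambda_{\max},\lambda_{\min}$ are the largest and smallest eigenvalues. Model: $X=(X_O,X_H)$ is a $(p+r)$-variate (mean zero) Gaussian vector; only the $p$ coordinates $X_O$ are observed. $\Sigma_O^{\ast}$ is the $p\times p$ covariance matrix of $X_O$. The inverse decomposes as $(\Sigma_O^{\ast})^{-1}=S^{\ast}-L^{\ast}$, where $S^{\ast}=(s^{\ast}_{ij})$ is the concentration matrix of the observed variables conditioned on the latent ones and $L^{\ast}\succeq0$ is the low-rank matrix summarizing the marginalization over the latent variables. One observes $n$ i.i.d. copies $X_O^{(1)},\dots,X_O^{(n)}$ of $X_O$; the sample covariance matrix is $\Sigma_O^n=\frac1n\sum_{k=1}^nX_O^{(k)}(X_O^{(k)})^T$. The quantities $p,s_0(p),M_p,r_0(p)$ may vary with $n$. Standing assumptions: $S^{\ast}$ belongs to $$\mathcal{U}(s_0(p),M_p)=\Big\{S=(s_{ij}): S\succ0,\ \|S\|_{1\to1}\le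 M_p,\ \max_{1\le i\le p}\sum_{j=1}^p\mathbf 1\{s_{ij}\ne0\}\le s_0(p)\Big\};$$ $L^{\ast}$ has rank $r_0(p)$ and eigendecomposition $L^{\ast}=\sum_{i=1}^{r_0(p)}\lambda_iu_iu_i^T$ ($\lambda_i>0$, $u_i$ orthonormal), with $\|u_i\|_\infty\le\sqrt{c_0/p}$ for all $i$ for a universal constant $c_0$, and $\|L^{\ast}\|_{1\to1}\le M_p$; and $\lambda_{\max}(\Sigma_O^{\ast})\le M$, $\lambda_{\min}(\Sigma_O^{\ast})\ge1/M$ for a universal constant $M$. Estimators: let $\hat S_1=(\hat s^1_{ij})$ be a solution of $$\min\|S\|_1\quad\text{subject to}\quad\|\Sigma_O^nS-I\|_\infty\le\tau_n,\ S\in\mathbb{R}^{p\times p}$$ (defined arbitrarily if the problem is infeasible). The symmetric matrix $\hat S=(\hat s_{ij})$ is obtained by keeping, for each pair $i\le j$, the entry of smaller magnitude among $\hat s^1_{ij},\hat s^1_{ji}$: $\hat s_{ij}=\hat s_{ji}=\hat s^1_{ij}\mathbf 1\{|\hat s^1_{ij}|\le|\hat s^1_{ji}|\}+\hat s^1_{ji}\mathbf 1\{|\hat s^1_{ij}|>|\hat s^1_{ji}|\}$. The thresholded estimator $\tilde S=(\tilde s_{ij})$ is $\tilde s_{ij}=\hat s_{ij}\mathbf 1\{|\hat s_{ij}|>9M_p\tau_n\}$. *)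

theory Defs
  imports
    "HOL-Probability.Probability"
    "Jordan_Normal_Form.DL_Rank"
    "Jordan_Normal_Form.Spectral_Radius"
begin

unbundle no vec_syntax
unbundle no inner_syntax
hide_const (open) Finite_Cartesian_Product.vec Finite_Cartesian_Product.mat
hide_type (open) Finite_Cartesian_Product.vec

text \<open>Because the dimension varies with the sample size, matrices and vectors are taken from
  \<^theory>\<open>Jordan_Normal_Form.Matrix\<close>, whose dimensions are values rather than types.
  Maxima and minima below are over finite sets, nonempty as soon as the dimensions are positive.\<close>

definition max_norm_mat :: "real mat \<Rightarrow> real" where
  "max_norm_mat A = Max {\<bar>A $$ (i, j)\<bar> |i j. i < dim_row A \<and> j < dim_col A}"

definition l1_norm_mat :: "real mat \<Rightarrow> real" where
  "l1_norm_mat A = (\<Sum>i<dim_row A. \<Sum>j<dim_col A. \<bar>A $$ (i, j)\<bar>)"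

text \<open>The maximal absolute row sum; it is the operator norm on \<open>l1\<close> for symmetric matrices,
  the only ones it is applied to.\<close>

definition l1_op_norm_mat :: "real mat \<Rightarrow> real" where
  "l1_op_norm_mat A = Max {\<Sum>j<dim_col A. \<bar>A $$ (i, j)\<bar> |i. i < dim_row A}"

definition max_norm_vec :: "real vec \<Rightarrow> real" where
  "max_norm_vec u = Max {\<bar>u $ i\<bar> |i. i < dim_vec u}"

definition lambda_max :: "real mat \<Rightarrow> real" where
  "lambda_max A = Max (spectrum A)"

definition lambda_min :: "real mat \<Rightarrow> real" where
  "lambda_min A = Min (spectrum A)"

definition sym_pos_def :: "nat \<Rightarrow> real mat \<Rightarrow> bool" where
  "sym_pos_def p A \<longleftrightarrow> A \<in> carrier_mat p p \<and> transpose_mat A = A \<and>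
     (\<forall>v \<in> carrier_vec p. v \<noteq> 0\<^sub>v p \<longrightarrow> v \<bullet> (A *\<^sub>v v) > 0)"

definition sign_mat :: "real mat \<Rightarrow> real mat" where
  "sign_mat A = map_mat sgn A"

definition min_nonzero_entry :: "real mat \<Rightarrow> real" where
  "min_nonzero_entry A =
     Min {\<bar>A $$ (i, j)\<bar> |i j. i < dim_row A \<and> j < dim_col A \<and> A $$ (i, j) \<noteq> 0}"

definition sparse_class :: "nat \<Rightarrow> nat \<Rightarrow> real \<Rightarrow> real mat set" where
  "sparse_class p s\<^sub>0 M\<^sub>p = {S. sym_pos_def p S \<and> l1_op_norm_mat S \<le> M\<^sub>p \<and>
     Max {card {j. j < p \<and> S $$ (i, j) \<noteq> 0} |i. i < p} \<le> s\<^sub>0}"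

definition eigendecomposition ::
    "nat \<Rightarrow> real mat \<Rightarrow> nat \<Rightarrow> (nat \<Rightarrow> real) \<Rightarrow> (nat \<Rightarrow> real vec) \<Rightarrow> bool" where
  "eigendecomposition p L r\<^sub>0 lam u \<longleftrightarrow>
     (\<forall>i<r\<^sub>0. lam i > 0 \<and> u i \<in> carrier_vec p) \<and>
     (\<forall>i<r\<^sub>0. \<forall>j<r\<^sub>0. u i \<bullet> u j = (if i = j then 1 else 0)) \<and>
     L = mat p p (\<lambda>(a, b). \<Sum>i<r\<^sub>0. lam i * u i $ a * u i $ b)"

text \<open>Random vectors of dimension \<open>d\<close> are measurable maps into the product space over
  \<open>{..<d}\<close>. A vector is Gaussian if all linear combinations of its coordinates are normal;
  the second disjunct is the normal distribution of variance 0.\<close>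

abbreviation vec_space_borel :: "nat \<Rightarrow> (nat \<Rightarrow> real) measure" where
  "vec_space_borel d \<equiv> PiM {..<d} (\<lambda>_. borel)"

definition centered_gaussian :: "'a measure \<Rightarrow> nat \<Rightarrow> ('a \<Rightarrow> nat \<Rightarrow> real) \<Rightarrow> bool" where
  "centered_gaussian Q d X \<longleftrightarrow> X \<in> measurable Q (vec_space_borel d) \<and>
     (\<forall>a :: nat \<Rightarrow> real.
        (\<exists>\<sigma>>0. distributed Q lborel (\<lambda>\<omega>. \<Sum>i<d. a i * X \<omega> i) (normal_density 0 \<sigma>)) \<or>
        (AE \<omega> in Q. (\<Sum>i<d. a i * X \<omega> i) = 0))"

text \<open>The covariance matrix of the first \<open>d\<close> coordinates.\<close>

definition covariance_mat :: "'a measure \<Rightarrow> nat \<Rightarrow> ('a \<Rightarrow> nat \<Rightarrow> real) \<Rightarrow> real mat" where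
  "covariance_mat Q d X = mat d d (\<lambda>(i, j).
     (\<integral>\<omega>. (X \<omega> i - (\<integral>\<omega>'. X \<omega>' i \<partial>Q)) * (X \<omega> j - (\<integral>\<omega>'. X \<omega>' j \<partial>Q)) \<partial>Q))"

text \<open>With \<open>K\<close> the joint concentration matrix of the observed and latent variables, the block
  \<open>S\<close> of \<open>K\<close> is the concentration matrix of the conditional distribution of the observed
  variables given the latent ones, and \<open>L\<close> is the correction of the Schur complement formula,
  due to marginalization over the latent variables.\<close>

definition latent_decomposition ::
    "nat \<Rightarrow> nat \<Rightarrow> real mat \<Rightarrow> real mat \<Rightarrow> real mat \<Rightarrow> bool" where
  "latent_decomposition p r \<Sigma> S L \<longleftrightarrow> (\<exists>B D D' K.
     S \<in> carrier_mat p p \<and> B \<in> carrier_mat p r \<and> D \<in> carrier_mat r r \<and> D' \<in> carrier_mat r r \<and>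
     K = four_block_mat S B (transpose_mat B) D \<and>
     inverts_mat \<Sigma> K \<and> inverts_mat K \<Sigma> \<and>
     inverts_mat D D' \<and> inverts_mat D' D \<and>
     L = B * D' * transpose_mat B)"

text \<open>The population vector \<open>X\<close> lives on \<open>Q\<close>; its coordinates below \<open>p\<close> are the observed ones,
  the remaining \<open>r\<close> are latent. The sample \<open>XO 1, \<dots>, XO n\<close> lives on \<open>P\<close>. The last assumption
  follows from the others by the Schur complement formula.\<close>

locale latent_gaussian_model =
  fixes Q :: "'v measure" and P :: "'w measure" and n p r :: nat
    and X :: "'v \<Rightarrow> nat \<Rightarrow> real" and XO :: "nat \<Rightarrow> 'w \<Rightarrow> nat \<Rightarrow> real"
    and S L :: "real mat"
  assumes dim_pos: "p \<ge> 1"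
    and prob_Q: "prob_space Q"
    and prob_P: "prob_space P"
    and gaussian: "centered_gaussian Q (p + r) X"
    and indep: "prob_space.indep_vars P (\<lambda>_. vec_space_borel p) XO {1..n}"
    and copies: "\<And>k. k \<in> {1..n} \<Longrightarrow>
      distr P (vec_space_borel p) (XO k) =
      distr Q (vec_space_borel p) (\<lambda>\<omega>. restrict (X \<omega>) {..<p})"
    and decomposition: "latent_decomposition p r (covariance_mat Q (p + r) X) S L"
    and inverse: "inverts_mat (covariance_mat Q p X) (S - L)"
      "inverts_mat (S - L) (covariance_mat Q p X)"

definition sample_covariance :: "nat \<Rightarrow> nat \<Rightarrow> (nat \<Rightarrow> nat \<Rightarrow> real) \<Rightarrow> real mat" where
  "sample_covariance n p x = mat p p (\<lambda>(i, j). (1 / real n) * (\<Sum>k=1..n. x k i * x k j))"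

definition clime_feasible :: "nat \<Rightarrow> real mat \<Rightarrow> real \<Rightarrow> real mat set" where
  "clime_feasible p \<Sigma>n \<tau> = {S \<in> carrier_mat p p. max_norm_mat (\<Sigma>n * S - 1\<^sub>m p) \<le> \<tau>}"

text \<open>A solution need not be unique, and is an arbitrary matrix if the problem is infeasible.\<close>

definition clime_solution :: "nat \<Rightarrow> real mat \<Rightarrow> real \<Rightarrow> real mat \<Rightarrow> bool" where
  "clime_solution p \<Sigma>n \<tau> S \<longleftrightarrow> S \<in> carrier_mat p p \<and>
     (clime_feasible p \<Sigma>n \<tau> \<noteq> {} \<longrightarrow>
        S \<in> clime_feasible p \<Sigma>n \<tau> \<and>
        (\<forall>T \<in> clime_feasible p \<Sigma>n \<tau>. l1_norm_mat S \<le> l1_norm_mat T))"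

text \<open>Ties in magnitude are resolved in favour of the entry on or above the diagonal.\<close>

definition symmetrize :: "real mat \<Rightarrow> real mat" where
  "symmetrize A = mat (dim_row A) (dim_col A) (\<lambda>(k, l).
     let i = min k l; j = max k l
     in if \<bar>A $$ (i, j)\<bar> \<le> \<bar>A $$ (j, i)\<bar> then A $$ (i, j) else A $$ (j, i))"

definition hard_threshold :: "real \<Rightarrow> real mat \<Rightarrow> real mat" where
  "hard_threshold t A = map_mat (\<lambda>x. if \<bar>x\<bar> > t then x else 0) A"

text \<open>A selected minimizer need not depend measurably on the data, so an event about it need not
  be measurable. ``With probability greater than \<open>q\<close>'' is therefore read as: the event contains a
  measurable event of probability greater than \<open>q\<close>. For measurable events this is the usual
  meaning, as the lemma shows.\<close>

definition with_prob_gt :: "'a measure \<Rightarrow> real \<Rightarrow> ('a \<Rightarrow> bool) \<Rightarrow> bool" where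
  "with_prob_gt P q A \<longleftrightarrow> (\<exists>E \<in> sets P. (\<forall>\<omega>\<in>E. A \<omega>) \<and> measure P E > q)"

lemma with_prob_gt_measurable:
  assumes "prob_space P" and "{\<omega> \<in> space P. A \<omega>} \<in> sets P"
  shows "with_prob_gt P q A \<longleftrightarrow> measure P {\<omega> \<in> space P. A \<omega>} > q"
proof
  interpret prob_space P by fact
  assume "with_prob_gt P q A"
  then obtain E where E: "E \<in> sets P" "\<forall>\<omega>\<in>E. A \<omega>" "measure P E > q"
    unfolding with_prob_gt_def by blast
  have "E \<subseteq> {\<omega> \<in> space P. A \<omega>}"
    using E sets.sets_into_space by blast
  then have "measure P E \<le> measure P {\<omega> \<in> space P. A \<omega>}"
    using assms(2) by (rule finite_measure_mono)
  then show "measure P {\<omega> \<in> space P. A \<omega>} > q" using E(3) by linarith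
next
  assume "measure P {\<omega> \<in> space P. A \<omega>} > q"
  then show "with_prob_gt P q A"
    unfolding with_prob_gt_def using assms(2) by (intro bexI[of _ "{\<omega> \<in> space P. A \<omega>}"]) auto
qed

end

theory Submission
  imports Defs
begin

text \<open>The matrix \<open>\<Omega> = S - L\<close> is the inverse of the observed covariance \<open>\<Sigma>\<close>, and its rows and columns
  have \<open>l1\<close> norm at most \<open>2 * M\<^sub>p\<close>. The proof compares the estimator with \<open>\<Omega>\<close>, and charges the bound
  on the entries of \<open>L\<close> only once, at the end.

  Suppose that the sample covariance \<open>\<Sigma>\<^sub>n\<close> is entrywise within \<open>t\<close> of \<open>\<Sigma>\<close>, where \<open>2 * M\<^sub>p * t \<le> \<tau>\<close>. Then
  \<open>\<Sigma>\<^sub>n * \<Omega> - 1 = (\<Sigma>\<^sub>n - \<Sigma>) * \<Omega>\<close> has entries at most \<open>\<tau>\<close>, so \<open>\<Omega>\<close> is feasible. Constraint and objective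
  separate over columns, hence each column of the minimizer \<open>S\<^sub>1\<close> has \<open>l1\<close> norm at most \<open>2 * M\<^sub>p\<close> as well
  (\<open>clime_column_minimal\<close>), and \<open>\<Sigma> * S\<^sub>1 - 1\<close> has entries at most \<open>2 * \<tau>\<close>. Multiplying by \<open>\<Omega>\<close> from
  the left gives \<open>\<bar>S\<^sub>1 - \<Omega>\<bar> \<le> 4 * M\<^sub>p * \<tau>\<close> entrywise (\<open>clime_entrywise_error\<close>). Symmetrization picks one
  of two entries that estimate the same entry of \<open>\<Omega>\<close>, and \<open>\<bar>L\<bar> \<le> M\<^sub>p * \<tau>\<close> entrywise, so the error with
  respect to \<open>S\<close> is at most \<open>5 * M\<^sub>p * \<tau>\<close> (\<open>latent_clime_error\<close>).

  The deviation \<open>t\<close> is of order \<open>sqrt (ln p / n)\<close>. By polarization a product of two coordinates is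
  a difference of squares of centered normal variables, for which the exact moment generating
  function gives a Chernoff bound (\<open>iid_square_mean_deviation\<close>); a union bound over the pairs of
  coordinates follows (\<open>sample_covariance_deviation\<close>). The variances in that bound are diagonal
  entries of \<open>\<Sigma>\<close>, which are at most the largest eigenvalue
  (\<open>symmetric_diag_entry_le_of_spectrum\<close>).

  The statements on signs are then deterministic: an entrywise error of at most half the gap
  separates the zero entries from the others (\<open>hard_threshold_sign_consistent\<close>).\<close>

section \<open>Diagonal entries and eigenvalues of a symmetric matrix\<close>

text \<open>The Hermitian form of \<open>A\<close> at an eigenvector is \<open>z\<close> times a positive number, and equals its own
  conjugate because \<open>A\<close> is real and symmetric; so \<open>z\<close> is real. It is an eigenvalue over the reals
  because \<open>A\<close> and its complexification have the same characteristic polynomial.\<close>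

lemma real_symmetric_eigenvalue_real:
  fixes A :: "real mat"
  assumes A: "A \<in> carrier_mat p p" and sym: "transpose_mat A = A"
    and ev: "eigenvalue (map_mat complex_of_real A) z"
  shows "\<exists>x. z = complex_of_real x \<and> eigenvalue A x"
proof -
  let ?C = "map_mat complex_of_real A"
  have C: "?C \<in> carrier_mat p p" using A by simp
  obtain v where v: "v \<in> carrier_vec p" "v \<noteq> 0\<^sub>v p" "?C *\<^sub>v v = z \<cdot>\<^sub>v v"
    using ev A unfolding eigenvalue_def eigenvector_def by auto
  have row: "(\<Sum>j<p. complex_of_real (A $$ (i, j)) * v $ j) = z * v $ i" if "i < p" for i
    using arg_cong[OF v(3), of "\<lambda>w. w $ i"] that A v(1)
    by (simp add: scalar_prod_def atLeast0LessThan)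
  have symij: "A $$ (i, j) = A $$ (j, i)" if "i < p" "j < p" for i j
    using arg_cong[OF sym, of "\<lambda>B. B $$ (j, i)"] that A by simp
  define q where "q = (\<Sum>i<p. \<Sum>j<p. cnj (v $ i) * complex_of_real (A $$ (i, j)) * v $ j)"
  define N where "N = (\<Sum>i<p. cnj (v $ i) * v $ i)"
  have q1: "q = z * N"
    unfolding q_def N_def sum_distrib_left
  proof (intro sum.cong refl)
    fix i assume "i \<in> {..<p}"
    then have "(\<Sum>j<p. cnj (v $ i) * complex_of_real (A $$ (i, j)) * v $ j) = cnj (v $ i) * (z * v $ i)"
      by (subst row[symmetric]) (auto simp: sum_distrib_left mult.assoc)
    then show "(\<Sum>j<p. cnj (v $ i) * complex_of_real (A $$ (i, j)) * v $ j) = z * (cnj (v $ i) * v $ i)"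
      by simp
  qed
  have "cnj q = (\<Sum>i<p. \<Sum>j<p. v $ i * complex_of_real (A $$ (i, j)) * cnj (v $ j))"
    unfolding q_def by simp
  also have "\<dots> = (\<Sum>j<p. \<Sum>i<p. v $ i * complex_of_real (A $$ (i, j)) * cnj (v $ j))"
    by (rule sum.swap)
  also have "\<dots> = q"
    unfolding q_def by (intro sum.cong refl) (auto simp: symij mult_ac)
  finally have cq: "cnj q = q" .
  have N: "N = complex_of_real (\<Sum>i<p. (cmod (v $ i))\<^sup>2)"
    unfolding N_def of_real_sum by (intro sum.cong refl) (simp only: complex_norm_square mult.commute)
  have "N \<noteq> 0"
  proof
    assume "N = 0"
    then have "(\<Sum>i<p. (cmod (v $ i))\<^sup>2) = 0" unfolding N by (simp only: of_real_eq_0_iff)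
    then have "\<forall>i<p. v $ i = 0" by (subst (asm) sum_nonneg_eq_0_iff) auto
    then have "v = 0\<^sub>v p" using v(1) by auto
    then show False using v(2) by simp
  qed
  moreover have "cnj N = N" unfolding N by simp
  ultimately have "cnj z = z" using cq unfolding q1 by auto
  then have z: "z = complex_of_real (Re z)"
    by (simp add: complex_eq_iff)
  have "poly (char_poly ?C) z = 0"
    using ev eigenvalue_root_char_poly[OF C] by simp
  moreover have "char_poly ?C = map_poly complex_of_real (char_poly A)"
    by (rule of_real_hom.char_poly_hom[OF A])
  ultimately have "poly (map_poly complex_of_real (char_poly A)) (complex_of_real (Re z)) = 0"
    using z by metis
  then have "poly (char_poly A) (Re z) = 0" by simp
  then show ?thesis using z eigenvalue_root_char_poly[OF A] by blast
qed

lemma mat_mult_entry: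
  fixes A B :: "real mat"
  assumes "A \<in> carrier_mat p p" "B \<in> carrier_mat p p" "i < p" "j < p"
  shows "(A * B) $$ (i, j) = (\<Sum>k<p. A $$ (i, k) * B $$ (k, j))"
  using assms by (simp add: scalar_prod_def atLeast0LessThan)

lemma pow_mat_add:
  assumes A: "A \<in> carrier_mat p p"
  shows "A ^\<^sub>m (k + l) = A ^\<^sub>m k * A ^\<^sub>m l"
proof (induction l)
  case 0
  then show ?case using right_mult_one_mat[OF pow_carrier_mat[OF A, of k]] A by simp
next
  case (Suc l)
  then show ?case
    using assoc_mult_mat[OF pow_carrier_mat[OF A, of k] pow_carrier_mat[OF A, of l] A] by simp
qed

text \<open>The diagonal entry of the square of a symmetric matrix is the sum of squares of a row, hence at
  least the square of the diagonal entry. Repeated squaring iterates this.\<close>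

lemma symmetric_power_diag_lower:
  fixes A :: "real mat"
  assumes A: "A \<in> carrier_mat p p" and sym: "transpose_mat A = A" and i: "i < p"
  shows "transpose_mat (A ^\<^sub>m (2 ^ k)) = A ^\<^sub>m (2 ^ k) \<and>
    \<bar>A $$ (i, i)\<bar> ^ (2 ^ k) \<le> \<bar>(A ^\<^sub>m (2 ^ k)) $$ (i, i)\<bar>"
proof (induction k)
  case 0
  then show ?case using A sym by simp
next
  case (Suc k)
  let ?B = "A ^\<^sub>m (2 ^ k)"
  have B: "?B \<in> carrier_mat p p" using A by simp
  have sq: "A ^\<^sub>m (2 ^ Suc k) = ?B * ?B"
    using pow_mat_add[OF A, of "2 ^ k" "2 ^ k"] by (simp add: mult_2)
  have symB: "?B $$ (l, i) = ?B $$ (i, l)" if "l < p" for l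
    using arg_cong[OF conjunct1[OF Suc.IH], of "\<lambda>B. B $$ (i, l)"] that i carrier_matD[OF B] by (simp only: index_transpose_mat)
  have "transpose_mat (?B * ?B) = ?B * ?B"
    using transpose_mult[OF B B] Suc.IH by simp
  moreover have "\<bar>A $$ (i, i)\<bar> ^ (2 ^ Suc k) \<le> (?B $$ (i, i))\<^sup>2"
    using power_mono[OF conjunct2[OF Suc.IH], of 2] by (simp add: power_mult[symmetric] mult.commute)
  moreover have "(?B $$ (i, i))\<^sup>2 \<le> (?B * ?B) $$ (i, i)"
  proof -
    have "(?B * ?B) $$ (i, i) = (\<Sum>l<p. (?B $$ (i, l))\<^sup>2)"
      unfolding mat_mult_entry[OF B B i i]
      by (intro sum.cong refl) (simp add: symB power2_eq_square)
    moreover have "(?B $$ (i, i))\<^sup>2 \<le> (\<Sum>l<p. (?B $$ (i, l))\<^sup>2)"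
      using i by (intro member_le_sum) auto
    ultimately show ?thesis by simp
  qed
  ultimately show ?case unfolding sq by linarith
qed

text \<open>This is the Rayleigh quotient bound at a standard basis vector, obtained from the growth of
  powers instead of an orthonormal eigenbasis: for \<open>c > b\<close> the matrix \<open>A / c\<close> has spectral radius
  below 1, so its powers are bounded, whereas a diagonal entry of \<open>A / c\<close> beyond 1 would make the
  corresponding entries of the powers with exponent \<open>2 ^ k\<close> unbounded.\<close>

lemma symmetric_diag_entry_le_of_spectrum:
  fixes A :: "real mat"
  assumes A: "A \<in> carrier_mat p p" and sym: "transpose_mat A = A" and i: "i < p"
    and sp: "\<And>x. x \<in> spectrum A \<Longrightarrow> \<bar>x\<bar> \<le> b"
  shows "\<bar>A $$ (i, i)\<bar> \<le> b"
proof (rule dense_ge)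
  fix c assume c: "b < c"
  let ?C = "map_mat complex_of_real A"
  have p: "p > 0" using i by simp
  have C: "?C \<in> carrier_mat p p" using A by simp
  have re: "cmod z \<le> b" if "z \<in> spectrum ?C" for z
  proof -
    have "eigenvalue ?C z" using that unfolding spectrum_def by simp
    then obtain x where "z = complex_of_real x" "eigenvalue A x"
      using real_symmetric_eigenvalue_real[OF A sym] by blast
    then show ?thesis using sp[of x] unfolding spectrum_def by simp
  qed
  then have "0 \<le> b" using spectrum_non_empty[OF C p]
    by (metis equals0I norm_ge_zero order_trans)
  then have cpos: "c > 0" using c by simp
  \<comment> \<open>The strict inequality \<open>b < c\<close> leaves room for a spectral radius strictly below 1.\<close>
  define B where "B = (1 / c) \<cdot>\<^sub>m A"
  let ?D = "map_mat complex_of_real B"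
  have B: "B \<in> carrier_mat p p" unfolding B_def using A by simp
  have symB: "transpose_mat B = B"
  proof -
    have "A $$ (l, k) = A $$ (k, l)" if "l < p" "k < p" for l k
      using arg_cong[OF sym, of "\<lambda>M. M $$ (k, l)"] that A by simp
    then show ?thesis unfolding B_def using A by (intro eq_matI) auto
  qed
  have D: "?D \<in> carrier_mat p p" using B by simp
  have "cmod z < 1" if z: "z \<in> spectrum ?D" for z
  proof -
    obtain v where v: "v \<in> carrier_vec p" "v \<noteq> 0\<^sub>v p" "?D *\<^sub>v v = z \<cdot>\<^sub>v v"
      using z D unfolding spectrum_def eigenvalue_def eigenvector_def by auto
    have "?C = complex_of_real c \<cdot>\<^sub>m ?D"
      using cpos A unfolding B_def by (intro eq_matI) auto
    then have "?C *\<^sub>v v = complex_of_real c \<cdot>\<^sub>v (?D *\<^sub>v v)"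
      using D v(1) by (intro eq_vecI) auto
    then have "?C *\<^sub>v v = (complex_of_real c * z) \<cdot>\<^sub>v v"
      unfolding v(3) by (simp add: smult_smult_assoc)
    then have "complex_of_real c * z \<in> spectrum ?C"
      using v C unfolding spectrum_def eigenvalue_def eigenvector_def by auto
    from re[OF this] have "c * cmod z \<le> b" using cpos by (simp add: norm_mult)
    then show ?thesis using c cpos by (smt (verit) mult_le_cancel_left1)
  qed
  then have "spectral_radius ?D < 1"
    using spectral_radius_mem_max(1)[OF D p] by auto
  from spectral_radius_jnf_norm_bound_less_1_upper_triangular[OF D this]
  obtain K where K: "norm_bound (?D ^\<^sub>m k) K" for k by blast
  have bd: "\<bar>B $$ (i, i)\<bar> ^ (2 ^ k) \<le> K" for k
  proof -
    have "?D ^\<^sub>m (2 ^ k) = map_mat complex_of_real (B ^\<^sub>m (2 ^ k))"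
      by (rule of_real_hom.mat_hom_pow[OF B, symmetric])
    then have "norm_bound (map_mat complex_of_real (B ^\<^sub>m (2 ^ k))) K" using K by metis
    then have "\<bar>(B ^\<^sub>m (2 ^ k)) $$ (i, i)\<bar> \<le> K"
      unfolding norm_bound_def using i B by auto
    then show ?thesis using symmetric_power_diag_lower[OF B symB i, of k] by linarith
  qed
  have "\<bar>B $$ (i, i)\<bar> \<le> 1"
  proof (rule ccontr)
    assume "\<not> \<bar>B $$ (i, i)\<bar> \<le> 1"
    then have gt: "1 < \<bar>B $$ (i, i)\<bar>" by simp
    then obtain m where m: "K < \<bar>B $$ (i, i)\<bar> ^ m" using real_arch_pow by blast
    have "\<bar>B $$ (i, i)\<bar> ^ m \<le> \<bar>B $$ (i, i)\<bar> ^ (2 ^ m)"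
      using gt by (intro power_increasing) (auto intro: less_imp_le)
    then show False using m bd[of m] by linarith
  qed
  then show "\<bar>A $$ (i, i)\<bar> \<le> c"
    using A i cpos unfolding B_def by (simp add: abs_mult divide_le_eq)
qed

section \<open>Deterministic error of the CLIME estimator\<close>

lemma max_norm_mat_le_iff:
  assumes "A \<in> carrier_mat m n" "0 < m" "0 < n"
  shows "max_norm_mat A \<le> b \<longleftrightarrow> (\<forall>i<m. \<forall>j<n. \<bar>A $$ (i, j)\<bar> \<le> b)"
proof -
  have eq: "{\<bar>A $$ (i, j)\<bar> |i j. i < dim_row A \<and> j < dim_col A} =
      (\<lambda>(i, j). \<bar>A $$ (i, j)\<bar>) ` ({..<m} \<times> {..<n})"
    using assms(1) by auto
  have "(0, 0) \<in> {..<m} \<times> {..<n}" using assms by simp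
  then have "{..<m} \<times> {..<n} \<noteq> {}" by blast
  then show ?thesis
    unfolding max_norm_mat_def eq by (subst Max_le_iff) auto
qed

lemma l1_op_norm_mat_le_iff:
  assumes "A \<in> carrier_mat m n" "0 < m"
  shows "l1_op_norm_mat A \<le> b \<longleftrightarrow> (\<forall>i<m. (\<Sum>j<n. \<bar>A $$ (i, j)\<bar>) \<le> b)"
proof -
  have eq: "{\<Sum>j<dim_col A. \<bar>A $$ (i, j)\<bar> |i. i < dim_row A} =
      (\<lambda>i. \<Sum>j<n. \<bar>A $$ (i, j)\<bar>) ` {..<m}"
    using assms(1) by auto
  have "{..<m} \<noteq> {}" using assms by auto
  then show ?thesis
    unfolding l1_op_norm_mat_def eq by (subst Max_le_iff) auto
qed

lemma clime_feasible_iff: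
  assumes Sn: "Sn \<in> carrier_mat p p" and U: "U \<in> carrier_mat p p" and p: "0 < p"
  shows "U \<in> clime_feasible p Sn \<tau> \<longleftrightarrow> (\<forall>i<p. \<forall>l<p.
    \<bar>(\<Sum>k<p. Sn $$ (i, k) * U $$ (k, l)) - (if i = l then 1 else 0)\<bar> \<le> \<tau>)"
proof -
  have c: "Sn * U - 1\<^sub>m p \<in> carrier_mat p p"
    by (metis one_carrier_mat minus_carrier_mat)
  have e: "(Sn * U - 1\<^sub>m p) $$ (i, l) = (\<Sum>k<p. Sn $$ (i, k) * U $$ (k, l)) - (if i = l then 1 else 0)"
    if "i < p" "l < p" for i l
    using that mat_mult_entry[OF Sn U that] by simp
  have "U \<in> clime_feasible p Sn \<tau> \<longleftrightarrow> (\<forall>i<p. \<forall>l<p. \<bar>(Sn * U - 1\<^sub>m p) $$ (i, l)\<bar> \<le> \<tau>)"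
    unfolding clime_feasible_def using U max_norm_mat_le_iff[OF c p p] by blast
  then show ?thesis using e by (metis (no_types, lifting))
qed

text \<open>Both the constraint and the objective are separable over columns: exchanging one column of a
  minimizer for the same column of any feasible matrix keeps feasibility, so it cannot decrease
  the norm.\<close>

lemma clime_column_minimal:
  assumes T: "T \<in> clime_feasible p Sn \<tau>" and Sn: "Sn \<in> carrier_mat p p"
    and sol: "clime_solution p Sn \<tau> S" and j: "j < p"
  shows "(\<Sum>i<p. \<bar>S $$ (i, j)\<bar>) \<le> (\<Sum>i<p. \<bar>T $$ (i, j)\<bar>)"
proof -
  have p: "0 < p" using j by simp
  have Sf: "S \<in> clime_feasible p Sn \<tau>"
    and min: "\<And>R. R \<in> clime_feasible p Sn \<tau> \<Longrightarrow> l1_norm_mat S \<le> l1_norm_mat R"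
    using sol T unfolding clime_solution_def by auto
  have S: "S \<in> carrier_mat p p" and Tc: "T \<in> carrier_mat p p"
    using Sf T unfolding clime_feasible_def by auto
  \<comment> \<open>The matrix \<open>S\<close> with column \<open>j\<close> taken from \<open>T\<close>.\<close>
  define R where "R = mat p p (\<lambda>(i, l). if l = j then T $$ (i, l) else S $$ (i, l))"
  have R: "R \<in> carrier_mat p p" unfolding R_def by simp
  have Rent: "R $$ (i, l) = (if l = j then T $$ (i, l) else S $$ (i, l))" if "i < p" "l < p" for i l
    using that unfolding R_def by simp
  note feas = clime_feasible_iff[OF Sn _ p]
  have "R \<in> clime_feasible p Sn \<tau>"
    unfolding feas[OF R]
  proof (intro allI impI)
    fix i l assume il: "i < p" "l < p"
    have "(\<Sum>k<p. Sn $$ (i, k) * R $$ (k, l)) =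
      (if l = j then (\<Sum>k<p. Sn $$ (i, k) * T $$ (k, l)) else (\<Sum>k<p. Sn $$ (i, k) * S $$ (k, l)))"
      using il by (simp add: Rent)
    then show "\<bar>(\<Sum>k<p. Sn $$ (i, k) * R $$ (k, l)) - (if i = l then 1 else 0)\<bar> \<le> \<tau>"
      using il Sf[unfolded feas[OF S]] T[unfolded feas[OF Tc]] by presburger
  qed
  from min[OF this]
  have "(\<Sum>i<p. \<Sum>l<p. \<bar>S $$ (i, l)\<bar>) \<le> (\<Sum>i<p. \<Sum>l<p. \<bar>R $$ (i, l)\<bar>)"
    using S R unfolding l1_norm_mat_def by simp
  moreover have "(\<Sum>i<p. \<Sum>l<p. \<bar>U $$ (i, l)\<bar>) = (\<Sum>l<p. \<Sum>i<p. \<bar>U $$ (i, l)\<bar>)" for U :: "real mat"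
    by (rule sum.swap)
  ultimately have "(\<Sum>l<p. \<Sum>i<p. \<bar>S $$ (i, l)\<bar>) \<le> (\<Sum>l<p. \<Sum>i<p. \<bar>R $$ (i, l)\<bar>)"
    by (simp only:)
  moreover have "(\<Sum>l<p. \<Sum>i<p. \<bar>U $$ (i, l)\<bar>) =
      (\<Sum>i<p. \<bar>U $$ (i, j)\<bar>) + (\<Sum>l\<in>{..<p}-{j}. \<Sum>i<p. \<bar>U $$ (i, l)\<bar>)" for U :: "real mat"
    using j by (intro sum.remove) auto
  moreover have "(\<Sum>l\<in>{..<p}-{j}. \<Sum>i<p. \<bar>S $$ (i, l)\<bar>) = (\<Sum>l\<in>{..<p}-{j}. \<Sum>i<p. \<bar>R $$ (i, l)\<bar>)"
    by (intro sum.cong refl) (auto simp: Rent)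
  moreover have "(\<Sum>i<p. \<bar>R $$ (i, j)\<bar>) = (\<Sum>i<p. \<bar>T $$ (i, j)\<bar>)"
    using j by (simp add: Rent)
  ultimately show ?thesis by (metis add_le_cancel_right)
qed

lemma abs_sum_mult_le:
  fixes f g :: "nat \<Rightarrow> real"
  assumes "\<And>k. k < p \<Longrightarrow> \<bar>f k\<bar> \<le> t" and "(\<Sum>k<p. \<bar>g k\<bar>) \<le> m" and "0 \<le> t"
  shows "\<bar>\<Sum>k<p. f k * g k\<bar> \<le> t * m"
proof -
  have "\<bar>\<Sum>k<p. f k * g k\<bar> \<le> (\<Sum>k<p. t * \<bar>g k\<bar>)"
    using assms(1) by (intro order_trans[OF sum_abs] sum_mono) (auto simp: abs_mult mult_right_mono)
  also have "\<dots> \<le> t * m"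
    using assms(2,3) by (simp add: sum_distrib_left[symmetric] mult_left_mono)
  finally show ?thesis .
qed

text \<open>The inverse \<open>Om\<close> is feasible because \<open>Sn * Om - 1 = (Sn - Sg) * Om\<close>. Column minimality then bounds
  the columns of \<open>S\<close> by those of \<open>Om\<close>, so that \<open>Sg * S - 1 = (Sn * S - 1) - (Sn - Sg) * S\<close> has entries at
  most \<open>2 * \<tau>\<close>, and \<open>S - Om = Om * (Sg * S - 1)\<close>.\<close>

lemma clime_entrywise_error:
  assumes Sn: "Sn \<in> carrier_mat p p" and Sg: "Sg \<in> carrier_mat p p"
    and Om: "Om \<in> carrier_mat p p"
    and inv: "Sg * Om = 1\<^sub>m p" "Om * Sg = 1\<^sub>m p"
    and rows: "\<And>i. i < p \<Longrightarrow> (\<Sum>k<p. \<bar>Om $$ (i, k)\<bar>) \<le> m"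
    and cols: "\<And>j. j < p \<Longrightarrow> (\<Sum>k<p. \<bar>Om $$ (k, j)\<bar>) \<le> m"
    and dev: "\<And>i j. i < p \<Longrightarrow> j < p \<Longrightarrow> \<bar>Sn $$ (i, j) - Sg $$ (i, j)\<bar> \<le> t"
    and t: "t * m \<le> \<tau>"
    and sol: "clime_solution p Sn \<tau> S"
    and ij: "i < p" "j < p"
  shows "\<bar>S $$ (i, j) - Om $$ (i, j)\<bar> \<le> 2 * m * \<tau>"
proof -
  have p: "0 < p" using ij by simp
  have t0: "0 \<le> t" using dev[OF p p] by linarith
  have SO: "(\<Sum>k<p. Sg $$ (i, k) * Om $$ (k, l)) = (if i = l then 1 else 0)" if "i < p" "l < p" for i l
    using mat_mult_entry[OF Sg Om that] that unfolding inv by simp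
  note cf = clime_feasible_iff[OF Sn _ p]
  have Omf: "Om \<in> clime_feasible p Sn \<tau>"
    unfolding cf[OF Om]
  proof (intro allI impI)
    fix i l assume il: "i < p" "l < p"
    have "(\<Sum>k<p. Sn $$ (i, k) * Om $$ (k, l)) - (if i = l then 1 else 0) =
        (\<Sum>k<p. (Sn $$ (i, k) - Sg $$ (i, k)) * Om $$ (k, l))"
      unfolding SO[OF il, symmetric] by (simp add: sum_subtractf left_diff_distrib)
    moreover have "\<bar>\<Sum>k<p. (Sn $$ (i, k) - Sg $$ (i, k)) * Om $$ (k, l)\<bar> \<le> t * m"
      using il t0 by (intro abs_sum_mult_le dev cols)
    ultimately show "\<bar>(\<Sum>k<p. Sn $$ (i, k) * Om $$ (k, l)) - (if i = l then 1 else 0)\<bar> \<le> \<tau>"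
      using t by linarith
  qed
  have Sf: "S \<in> clime_feasible p Sn \<tau>" using sol Omf unfolding clime_solution_def by auto
  then have S: "S \<in> carrier_mat p p" unfolding clime_feasible_def by auto
  have Scol: "(\<Sum>k<p. \<bar>S $$ (k, l)\<bar>) \<le> m" if "l < p" for l
    using clime_column_minimal[OF Omf Sn sol that] cols[OF that] by linarith
  let ?R = "\<lambda>k l. (\<Sum>h<p. Sg $$ (k, h) * S $$ (h, l)) - (if k = l then 1 else 0 :: real)"
  have R: "\<bar>?R k l\<bar> \<le> 2 * \<tau>" if kl: "k < p" "l < p" for k l
  proof -
    have "(\<Sum>h<p. (Sn $$ (k, h) - Sg $$ (k, h)) * S $$ (h, l)) =
        (\<Sum>h<p. Sn $$ (k, h) * S $$ (h, l)) - (\<Sum>h<p. Sg $$ (k, h) * S $$ (h, l))"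
      by (simp add: sum_subtractf left_diff_distrib)
    moreover have "\<bar>\<Sum>h<p. (Sn $$ (k, h) - Sg $$ (k, h)) * S $$ (h, l)\<bar> \<le> t * m"
      using kl t0 by (intro abs_sum_mult_le dev Scol)
    moreover have "\<bar>(\<Sum>h<p. Sn $$ (k, h) * S $$ (h, l)) - (if k = l then 1 else 0)\<bar> \<le> \<tau>"
      using Sf kl unfolding cf[OF S] by blast
    ultimately show ?thesis using t by linarith
  qed
  have eq: "S $$ (i, j) - Om $$ (i, j) = (\<Sum>k<p. ?R k j * Om $$ (i, k))"
  proof -
    have "(Om * (Sg * S)) $$ (i, j) = S $$ (i, j)"
      using assoc_mult_mat[OF Om Sg S] S unfolding inv by simp
    then have "(\<Sum>k<p. Om $$ (i, k) * (\<Sum>h<p. Sg $$ (k, h) * S $$ (h, j))) = S $$ (i, j)"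
      using mat_mult_entry[OF Om mult_carrier_mat[OF Sg S] ij] mat_mult_entry[OF Sg S _ ij(2)]
      by simp
    moreover have "(\<Sum>k<p. Om $$ (i, k) * (if k = j then 1 else 0)) = Om $$ (i, j)"
      using ij by (simp add: if_distrib cong: if_cong)
    moreover have "(\<Sum>k<p. ?R k j * Om $$ (i, k)) =
        (\<Sum>k<p. Om $$ (i, k) * (\<Sum>h<p. Sg $$ (k, h) * S $$ (h, j))) -
        (\<Sum>k<p. Om $$ (i, k) * (if k = j then 1 else 0))"
      unfolding sum_subtractf[symmetric]
      by (intro sum.cong refl trans[OF mult.commute right_diff_distrib])
    ultimately show ?thesis by (simp only:)
  qed
  have "0 \<le> \<tau>" using R[OF p p] by linarith
  then have "\<bar>\<Sum>k<p. ?R k j * Om $$ (i, k)\<bar> \<le> (2 * \<tau>) * m"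
    using ij by (intro abs_sum_mult_le R rows) auto
  then show ?thesis unfolding eq by (simp add: mult_ac)
qed

section \<open>Concentration of squares of centered normal variables\<close>

text \<open>Up to the factor \<open>1 / q\<close>, the integrand is the centered normal density of standard deviation
  \<open>\<sigma> / q\<close>, where \<open>q\<^sup>2 = 1 - 2 * a * \<sigma>\<^sup>2\<close>.\<close>

lemma normal_square_mgf:
  fixes \<sigma> a :: real
  assumes s: "\<sigma> > 0" and a: "2 * a * \<sigma>\<^sup>2 < 1"
  shows "integrable lborel (\<lambda>x. normal_density 0 \<sigma> x * exp (a * x\<^sup>2))"
    and "(\<integral>x. normal_density 0 \<sigma> x * exp (a * x\<^sup>2) \<partial>lborel) = 1 / sqrt (1 - 2 * a * \<sigma>\<^sup>2)"
proof -
  define q where "q = sqrt (1 - 2 * a * \<sigma>\<^sup>2)"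
  have q: "q > 0" and q2: "q\<^sup>2 = 1 - 2 * a * \<sigma>\<^sup>2" unfolding q_def using a by simp_all
  have eq: "normal_density 0 \<sigma> x * exp (a * x\<^sup>2) = normal_density 0 (\<sigma> / q) x * (1 / q)" for x
  proof -
    have "- (x\<^sup>2 / (2 * \<sigma>\<^sup>2)) + a * x\<^sup>2 = - (x\<^sup>2 / (2 * (\<sigma> / q)\<^sup>2))"
      unfolding power_divide q2 using s by (simp add: field_simps)
    then have e: "exp (- (x\<^sup>2 / (2 * \<sigma>\<^sup>2))) * exp (a * x\<^sup>2) = exp (- (x\<^sup>2 / (2 * (\<sigma> / q)\<^sup>2)))"
      by (simp only: exp_add[symmetric])
    have r: "1 / sqrt (2 * pi * \<sigma>\<^sup>2) = 1 / sqrt (2 * pi * (\<sigma> / q)\<^sup>2) * (1 / q)"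
      using s q by (simp add: real_sqrt_mult field_simps real_sqrt_divide)
    show ?thesis unfolding normal_density_def using e r by simp
  qed
  have sq: "\<sigma> / q > 0" using s q by simp
  show "integrable lborel (\<lambda>x. normal_density 0 \<sigma> x * exp (a * x\<^sup>2))"
    unfolding eq using sq by (intro integrable_mult_left) simp
  show "(\<integral>x. normal_density 0 \<sigma> x * exp (a * x\<^sup>2) \<partial>lborel) = 1 / sqrt (1 - 2 * a * \<sigma>\<^sup>2)"
    unfolding eq using integral_normal_density[OF sq] by (simp add: q_def)
qed

text \<open>The left-hand side is the moment generating function at \<open>y\<close> of \<open>Z\<^sup>2 - 1\<close> with \<open>Z\<close> standard normal. Near
  0 its logarithm is quadratic, which gives tails of Gaussian type for small deviations.\<close>

lemma inverse_sqrt_mgf_bound: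
  fixes y :: real
  assumes "\<bar>y\<bar> \<le> 1 / 4"
  shows "exp (- y) / sqrt (1 - 2 * y) \<le> exp (4 * y\<^sup>2)"
proof -
  have pos: "0 < 1 - 2 * y" using assms by linarith
  have "\<bar>ln (1 + (- 2 * y)) - (- 2 * y)\<bar> \<le> 2 * (- 2 * y)\<^sup>2"
    using assms by (intro abs_ln_one_plus_x_minus_x_bound) auto
  then have "ln (1 - 2 * y) \<ge> - 2 * y - 8 * y\<^sup>2"
    by (simp add: power2_eq_square)
  then have "- y - ln (1 - 2 * y) / 2 \<le> 4 * y\<^sup>2" by simp
  moreover have "exp (- y) / sqrt (1 - 2 * y) = exp (- y - ln (1 - 2 * y) / 2)"
    using pos by (simp add: exp_diff exp_minus powr_half_sqrt[symmetric] powr_def mult.commute)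
  ultimately show ?thesis by simp
qed

text \<open>The one-dimensional instance of \<^const>\<open>centered_gaussian\<close>, which also allows variance 0; that
  case occurs for the differences \<open>X i - X j\<close>, for instance when \<open>i = j\<close>.\<close>

definition centered_normal :: "'a measure \<Rightarrow> ('a \<Rightarrow> real) \<Rightarrow> bool" where
  "centered_normal Q Y \<longleftrightarrow> Y \<in> borel_measurable Q \<and>
     ((\<exists>\<sigma>>0. distributed Q lborel Y (normal_density 0 \<sigma>)) \<or> (AE \<omega> in Q. Y \<omega> = 0))"

lemma centered_normal_moments:
  assumes Q: "prob_space Q" and Y: "centered_normal Q Y"
  shows "integrable Q Y" "(\<integral>\<omega>. Y \<omega> \<partial>Q) = 0" "integrable Q (\<lambda>\<omega>. (Y \<omega>)\<^sup>2)"
proof -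
  interpret prob_space Q by fact
  have m[measurable]: "Y \<in> borel_measurable Q" using Y unfolding centered_normal_def by simp
  have "integrable Q Y \<and> (\<integral>\<omega>. Y \<omega> \<partial>Q) = 0 \<and> integrable Q (\<lambda>\<omega>. (Y \<omega>)\<^sup>2)"
  proof (cases "AE \<omega> in Q. Y \<omega> = 0")
    case True
    have "integrable Q Y \<longleftrightarrow> integrable Q (\<lambda>_. 0::real)"
      using True by (intro integrable_cong_AE) auto
    moreover have "(\<integral>\<omega>. Y \<omega> \<partial>Q) = (\<integral>\<omega>. 0 \<partial>Q)"
      using True by (intro integral_cong_AE) auto
    moreover have "integrable Q (\<lambda>\<omega>. (Y \<omega>)\<^sup>2) \<longleftrightarrow> integrable Q (\<lambda>_. 0::real)"
      using True by (intro integrable_cong_AE) auto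
    ultimately show ?thesis by simp
  next
    case False
    then obtain \<sigma> where s: "\<sigma> > 0" and D: "distributed Q lborel Y (normal_density 0 \<sigma>)"
      using Y unfolding centered_normal_def by blast
    have "integrable Q Y"
      using distributed_integrable[OF D, of "\<lambda>x. x"] integrable_normal_moment[OF s, of 0 1] by simp
    moreover have "integrable Q (\<lambda>\<omega>. (Y \<omega>)\<^sup>2)"
      using distributed_integrable[OF D, of "\<lambda>x. x\<^sup>2"] integrable_normal_moment[OF s, of 0 2] by simp
    ultimately show ?thesis using normal_distributed_expectation[OF s D] by simp
  qed
  then show "integrable Q Y" "(\<integral>\<omega>. Y \<omega> \<partial>Q) = 0" "integrable Q (\<lambda>\<omega>. (Y \<omega>)\<^sup>2)" by auto
qed

text \<open>The bound depends on an upper bound \<open>V\<close> of the variance only, so that a single choice of \<open>a\<close> serves all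
  pairs of coordinates, degenerate ones included.\<close>

lemma centered_normal_square_mgf:
  assumes Q: "prob_space Q" and Y: "centered_normal Q Y"
    and v: "(\<integral>\<omega>. (Y \<omega>)\<^sup>2 \<partial>Q) \<le> V" and a: "\<bar>a\<bar> * V \<le> 1 / 4"
  shows "integrable Q (\<lambda>\<omega>. exp (a * ((Y \<omega>)\<^sup>2 - (\<integral>\<omega>. (Y \<omega>)\<^sup>2 \<partial>Q))))"
    and "(\<integral>\<omega>. exp (a * ((Y \<omega>)\<^sup>2 - (\<integral>\<omega>. (Y \<omega>)\<^sup>2 \<partial>Q))) \<partial>Q) \<le> exp (4 * a\<^sup>2 * V\<^sup>2)"
proof -
  interpret prob_space Q by fact
  define v where "v = (\<integral>\<omega>. (Y \<omega>)\<^sup>2 \<partial>Q)"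
  have v0: "0 \<le> v" unfolding v_def by simp
  have vV: "v \<le> V" using assms(3) unfolding v_def .
  have m[measurable]: "Y \<in> borel_measurable Q" using Y unfolding centered_normal_def by simp
  have "integrable Q (\<lambda>\<omega>. exp (a * ((Y \<omega>)\<^sup>2 - v))) \<and>
    (\<integral>\<omega>. exp (a * ((Y \<omega>)\<^sup>2 - v)) \<partial>Q) \<le> exp (4 * a\<^sup>2 * V\<^sup>2)"
  proof (cases "AE \<omega> in Q. Y \<omega> = 0")
    case True
    have "v = (\<integral>\<omega>. 0 \<partial>Q)" unfolding v_def using True by (intro integral_cong_AE) auto
    then have v00: "v = 0" by simp
    have "integrable Q (\<lambda>\<omega>. exp (a * ((Y \<omega>)\<^sup>2 - v))) \<longleftrightarrow> integrable Q (\<lambda>_. 1::real)"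
      using True by (intro integrable_cong_AE) (auto simp: v00)
    moreover have "(\<integral>\<omega>. exp (a * ((Y \<omega>)\<^sup>2 - v)) \<partial>Q) = (\<integral>\<omega>. 1 \<partial>Q)"
      using True by (intro integral_cong_AE) (auto simp: v00)
    ultimately show ?thesis by (simp add: prob_space)
  next
    case False
    then obtain \<sigma> where s: "\<sigma> > 0" and D: "distributed Q lborel Y (normal_density 0 \<sigma>)"
      using Y unfolding centered_normal_def by blast
    have vs: "v = \<sigma>\<^sup>2"
      using normal_distributed_variance[OF s D] normal_distributed_expectation[OF s D]
      unfolding v_def by simp
    have av: "\<bar>a * v\<bar> \<le> 1 / 4"
      using a v0 vV mult_left_mono[OF vV, of "\<bar>a\<bar>"] by (simp add: abs_mult)
    then have lt: "2 * a * \<sigma>\<^sup>2 < 1" unfolding vs[symmetric] by linarith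
    have I: "integrable Q (\<lambda>\<omega>. exp (a * (Y \<omega>)\<^sup>2))"
      using distributed_integrable[OF D, of "\<lambda>x. exp (a * x\<^sup>2)"] normal_square_mgf(1)[OF s lt] by simp
    have E: "(\<integral>\<omega>. exp (a * (Y \<omega>)\<^sup>2) \<partial>Q) = 1 / sqrt (1 - 2 * (a * v))"
      using distributed_integral[OF D, of "\<lambda>x. exp (a * x\<^sup>2)"] normal_square_mgf(2)[OF s lt] vs
      by (simp add: mult.assoc)
    have split: "exp (a * ((Y \<omega>)\<^sup>2 - v)) = exp (- (a * v)) * exp (a * (Y \<omega>)\<^sup>2)" for \<omega>
      by (simp add: exp_add[symmetric] algebra_simps)
    have "(\<integral>\<omega>. exp (a * ((Y \<omega>)\<^sup>2 - v)) \<partial>Q) = exp (- (a * v)) / sqrt (1 - 2 * (a * v))"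
      unfolding split using E by simp
    also have "\<dots> \<le> exp (4 * (a * v)\<^sup>2)" by (rule inverse_sqrt_mgf_bound[OF av])
    also have "\<dots> \<le> exp (4 * a\<^sup>2 * V\<^sup>2)"
      using v0 vV by (simp add: power_mult_distrib mult_left_mono power_mono)
    finally show ?thesis unfolding split using I by simp
  qed
  then show "integrable Q (\<lambda>\<omega>. exp (a * ((Y \<omega>)\<^sup>2 - (\<integral>\<omega>. (Y \<omega>)\<^sup>2 \<partial>Q))))"
    "(\<integral>\<omega>. exp (a * ((Y \<omega>)\<^sup>2 - (\<integral>\<omega>. (Y \<omega>)\<^sup>2 \<partial>Q))) \<partial>Q) \<le> exp (4 * a\<^sup>2 * V\<^sup>2)"
    unfolding v_def by auto
qed

lemma (in prob_space) iid_sum_chernoff: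
  fixes Z :: "nat \<Rightarrow> 'a \<Rightarrow> real"
  assumes ind: "indep_vars (\<lambda>_. borel) Z {1..n}"
    and int: "\<And>k. k \<in> {1..n} \<Longrightarrow> integrable M (\<lambda>\<omega>. exp (Z k \<omega>))"
    and mgf: "\<And>k. k \<in> {1..n} \<Longrightarrow> expectation (\<lambda>\<omega>. exp (Z k \<omega>)) \<le> exp b"
  shows "prob {\<omega> \<in> space M. (\<Sum>k=1..n. Z k \<omega>) \<ge> c} \<le> exp (real n * b - c)"
proof -
  have m[measurable]: "\<And>k. k \<in> {1..n} \<Longrightarrow> Z k \<in> borel_measurable M"
    using ind unfolding indep_vars_def by auto
  have ind': "indep_vars (\<lambda>_. borel) (\<lambda>k \<omega>. exp (Z k \<omega>)) {1..n}"
    by (rule indep_vars_compose2[OF ind]) simp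
  have ex: "exp (\<Sum>k=1..n. Z k \<omega>) = (\<Prod>k=1..n. exp (Z k \<omega>))" for \<omega>
    by (simp add: exp_sum)
  have I: "integrable M (\<lambda>\<omega>. exp (\<Sum>k=1..n. Z k \<omega>))"
    unfolding ex by (rule indep_vars_integrable[OF _ ind' int]) auto
  have "expectation (\<lambda>\<omega>. exp (\<Sum>k=1..n. Z k \<omega>)) = (\<Prod>k=1..n. expectation (\<lambda>\<omega>. exp (Z k \<omega>)))"
    unfolding ex by (rule indep_vars_lebesgue_integral[OF _ ind' int]) auto
  also have "\<dots> \<le> (\<Prod>k=1..n. exp b)"
    by (intro prod_mono conjI mgf integral_nonneg_AE) auto
  finally have E: "expectation (\<lambda>\<omega>. exp (\<Sum>k=1..n. Z k \<omega>)) \<le> exp (real n * b)"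
    by (simp add: exp_of_nat_mult)
  have "prob {\<omega> \<in> space M. (\<Sum>k=1..n. Z k \<omega>) \<ge> c} = prob {\<omega> \<in> space M. exp (\<Sum>k=1..n. Z k \<omega>) \<ge> exp c}"
    by simp
  also have "\<dots> \<le> expectation (\<lambda>\<omega>. exp (\<Sum>k=1..n. Z k \<omega>)) / exp c"
    using I by (intro integral_Markov_inequality_measure[where A = "{}"]) auto
  also have "\<dots> \<le> exp (real n * b) / exp c"
    using E by (simp add: divide_right_mono)
  finally show ?thesis by (simp add: exp_diff)
qed

text \<open>Chernoff's bound with exponent \<open>4 * a\<^sup>2 * V\<^sup>2 - a * s\<close> per observation. It is minimal at
  \<open>a = s / (8 * V\<^sup>2)\<close>, and \<open>s \<le> 2 * V\<close> is what keeps this \<open>a\<close> in the range where the bound on the moment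
  generating function holds. The sign of \<open>a\<close> selects the upper or the lower tail.\<close>

lemma (in prob_space) iid_square_mean_deviation:
  fixes W :: "nat \<Rightarrow> 'a \<Rightarrow> real" and Y :: "'v \<Rightarrow> real"
  assumes Q: "prob_space Q" and Y: "centered_normal Q Y"
    and v: "(\<integral>\<omega>. (Y \<omega>)\<^sup>2 \<partial>Q) \<le> V" and V: "V > 0"
    and s: "0 \<le> s" "s \<le> 2 * V" and n: "n \<ge> 1"
    and ind: "indep_vars (\<lambda>_. borel) W {1..n}"
    and dist: "\<And>k. k \<in> {1..n} \<Longrightarrow> distr M borel (W k) = distr Q borel Y"
  shows "prob {\<omega> \<in> space M. \<bar>(1 / real n) * (\<Sum>k=1..n. (W k \<omega>)\<^sup>2) - (\<integral>\<omega>. (Y \<omega>)\<^sup>2 \<partial>Q)\<bar> > s}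
    \<le> 2 * exp (- (real n * s\<^sup>2 / (16 * V\<^sup>2)))"
proof -
  define v where "v = (\<integral>\<omega>. (Y \<omega>)\<^sup>2 \<partial>Q)"
  define a where "a = s / (8 * V\<^sup>2)"
  have Ym[measurable]: "Y \<in> borel_measurable Q" using Y unfolding centered_normal_def by simp
  have Wm: "\<And>k. k \<in> {1..n} \<Longrightarrow> W k \<in> borel_measurable M"
    using ind unfolding indep_vars_def by auto
  have aV: "\<bar>a\<bar> * V \<le> 1 / 4" "\<bar>- a\<bar> * V \<le> 1 / 4"
    using s V unfolding a_def by (auto simp: field_simps power2_eq_square)
  have tail: "prob {\<omega> \<in> space M. (\<Sum>k=1..n. c * ((W k \<omega>)\<^sup>2 - v)) \<ge> real n * (a * s)}
    \<le> exp (- (real n * s\<^sup>2 / (16 * V\<^sup>2)))" if c: "c = a \<or> c = - a" for c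
  proof -
    have "\<bar>c\<bar> * V \<le> 1 / 4" using c aV by auto
    note mgf = centered_normal_square_mgf[OF Q Y assms(3) this, folded v_def]
    have "integrable M (\<lambda>\<omega>. exp (c * ((W k \<omega>)\<^sup>2 - v))) \<and>
      expectation (\<lambda>\<omega>. exp (c * ((W k \<omega>)\<^sup>2 - v))) \<le> exp (4 * c\<^sup>2 * V\<^sup>2)" if k: "k \<in> {1..n}" for k
    proof -
      let ?g = "\<lambda>x::real. exp (c * (x\<^sup>2 - v))"
      have "integrable M (\<lambda>\<omega>. ?g (W k \<omega>)) \<longleftrightarrow> integrable Q (\<lambda>\<omega>. ?g (Y \<omega>))"
        using integrable_distr_eq[OF Wm[OF k], of ?g] integrable_distr_eq[OF Ym, of ?g] dist[OF k]
        by simp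
      moreover have "expectation (\<lambda>\<omega>. ?g (W k \<omega>)) = (\<integral>\<omega>. ?g (Y \<omega>) \<partial>Q)"
        using integral_distr[OF Wm[OF k], of ?g] integral_distr[OF Ym, of ?g] dist[OF k]
        by simp
      ultimately show ?thesis using mgf by simp
    qed
    note im = this
    have ind': "indep_vars (\<lambda>_. borel) (\<lambda>k \<omega>. c * ((W k \<omega>)\<^sup>2 - v)) {1..n}"
      by (rule indep_vars_compose2[OF ind]) simp
    have "prob {\<omega> \<in> space M. (\<Sum>k=1..n. c * ((W k \<omega>)\<^sup>2 - v)) \<ge> real n * (a * s)}
      \<le> exp (real n * (4 * c\<^sup>2 * V\<^sup>2) - real n * (a * s))"
      by (rule iid_sum_chernoff[OF ind']) (use im in auto)
    also have "c\<^sup>2 = a\<^sup>2" using c by auto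
    also have "real n * (4 * a\<^sup>2 * V\<^sup>2) - real n * (a * s) = - (real n * s\<^sup>2 / (16 * V\<^sup>2))"
      unfolding a_def using V by (simp add: field_simps power2_eq_square)
    finally show ?thesis .
  qed
  let ?D = "\<lambda>\<omega>. (1 / real n) * (\<Sum>k=1..n. (W k \<omega>)\<^sup>2) - v"
  have sumc: "(\<Sum>k=1..n. c * ((W k \<omega>)\<^sup>2 - v)) = real n * (c * ?D \<omega>)" for c \<omega>
    using n by (simp add: sum_distrib_left[symmetric] sum_subtractf field_simps)
  let ?A = "\<lambda>c. {\<omega> \<in> space M. (\<Sum>k=1..n. c * ((W k \<omega>)\<^sup>2 - v)) \<ge> real n * (a * s)}"
  have am: "?A c \<in> events" for c using Wm by measurable
  have "{\<omega> \<in> space M. \<bar>?D \<omega>\<bar> > s} \<subseteq> ?A a \<union> ?A (- a)"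
  proof
    fix \<omega> assume w: "\<omega> \<in> {\<omega> \<in> space M. \<bar>?D \<omega>\<bar> > s}"
    have "0 \<le> a" unfolding a_def using s by simp
    then have "a * s \<le> a * \<bar>?D \<omega>\<bar>" using w by (intro mult_left_mono) auto
    moreover have "a * \<bar>d\<bar> = a * d \<or> a * \<bar>d\<bar> = - a * d" for d :: real
      by (simp add: abs_if)
    ultimately have "a * s \<le> a * ?D \<omega> \<or> a * s \<le> - a * ?D \<omega>"
      by metis
    then have "real n * (a * s) \<le> real n * (a * ?D \<omega>) \<or> real n * (a * s) \<le> real n * (- a * ?D \<omega>)"
      by (meson mult_left_mono of_nat_0_le_iff)
    then show "\<omega> \<in> ?A a \<union> ?A (- a)" using w unfolding sumc by blast
  qed
  then have "prob {\<omega> \<in> space M. \<bar>?D \<omega>\<bar> > s} \<le> prob (?A a \<union> ?A (- a))"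
    by (rule finite_measure_mono) (rule sets.Un[OF am am])
  also have "\<dots> \<le> prob (?A a) + prob (?A (- a))"
    by (rule measure_Un_le[OF am am])
  also have "\<dots> \<le> 2 * exp (- (real n * s\<^sup>2 / (16 * V\<^sup>2)))"
    using tail[of a] tail[of "- a"] by linarith
  finally show ?thesis unfolding v_def .
qed

section \<open>Concentration of the sample covariance\<close>

lemma centered_gaussian_component_measurable:
  assumes "centered_gaussian Q d X" "i < d"
  shows "(\<lambda>\<omega>. X \<omega> i) \<in> borel_measurable Q"
  using assms measurable_compose[OF _ measurable_component_singleton[of i "{..<d}" "\<lambda>_. borel"]]
  unfolding centered_gaussian_def by auto

lemma centered_gaussian_pair_normal:
  assumes G: "centered_gaussian Q d X" and ij: "i < d" "j < d"
  shows "centered_normal Q (\<lambda>\<omega>. X \<omega> i + e * X \<omega> j)"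
proof -
  define a where "a k = (if k = i then 1 else 0) + (if k = j then e else 0)" for k
  have "(\<Sum>k<d. a k * X \<omega> k) = X \<omega> i + e * X \<omega> j" for \<omega>
  proof -
    have "(\<Sum>k<d. a k * X \<omega> k) =
        (\<Sum>k<d. if k = i then X \<omega> k else 0) + (\<Sum>k<d. if k = j then e * X \<omega> k else 0)"
      unfolding sum.distrib[symmetric] a_def by (intro sum.cong refl) (auto simp: algebra_simps)
    then show ?thesis using ij by simp
  qed
  moreover have "(\<exists>\<sigma>>0. distributed Q lborel (\<lambda>\<omega>. \<Sum>k<d. a k * X \<omega> k) (normal_density 0 \<sigma>)) \<or>
      (AE \<omega> in Q. (\<Sum>k<d. a k * X \<omega> k) = 0)"
    using G unfolding centered_gaussian_def by blast
  moreover have "(\<lambda>\<omega>. X \<omega> i + e * X \<omega> j) \<in> borel_measurable Q"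
    using centered_gaussian_component_measurable[OF G] ij by measurable
  ultimately show ?thesis unfolding centered_normal_def by simp
qed

text \<open>Integrability of the product follows by polarization from that of squares of linear
  combinations, and the means in the covariance vanish.\<close>

lemma centered_gaussian_covariance:
  assumes Q: "prob_space Q" and G: "centered_gaussian Q d X" and p: "p \<le> d" and ij: "i < p" "j < p"
  shows "integrable Q (\<lambda>\<omega>. X \<omega> i * X \<omega> j)"
    and "covariance_mat Q p X $$ (i, j) = (\<integral>\<omega>. X \<omega> i * X \<omega> j \<partial>Q)"
proof -
  have d: "i < d" "j < d" using ij p by auto
  have eq: "(\<lambda>\<omega>. X \<omega> i * X \<omega> j) =
      (\<lambda>\<omega>. (1 / 4) * (X \<omega> i + 1 * X \<omega> j)\<^sup>2 - (1 / 4) * (X \<omega> i + (- 1) * X \<omega> j)\<^sup>2)"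
    by (auto simp: power2_eq_square algebra_simps)
  show "integrable Q (\<lambda>\<omega>. X \<omega> i * X \<omega> j)"
    by (subst eq, intro Bochner_Integration.integrable_diff integrable_mult_right
        centered_normal_moments(3)[OF Q centered_gaussian_pair_normal[OF G d]])
  have "(\<integral>\<omega>. X \<omega> k \<partial>Q) = 0" if "k < d" for k
    using centered_normal_moments(2)[OF Q centered_gaussian_pair_normal[OF G that that, of 0]] by simp
  then show "covariance_mat Q p X $$ (i, j) = (\<integral>\<omega>. X \<omega> i * X \<omega> j \<partial>Q)"
    using ij d unfolding covariance_mat_def by simp
qed

lemma centered_gaussian_pair_second_moment:
  assumes Q: "prob_space Q" and G: "centered_gaussian Q d X" and p: "p \<le> d" and ij: "i < p" "j < p"
  shows "(\<integral>\<omega>. (X \<omega> i + e * X \<omega> j)\<^sup>2 \<partial>Q) =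
    covariance_mat Q p X $$ (i, i) + 2 * e * covariance_mat Q p X $$ (i, j)
      + e\<^sup>2 * covariance_mat Q p X $$ (j, j)"
proof -
  note c = centered_gaussian_covariance[OF Q G p]
  have "(\<lambda>\<omega>. (X \<omega> i + e * X \<omega> j)\<^sup>2) =
     (\<lambda>\<omega>. X \<omega> i * X \<omega> i + 2 * e * (X \<omega> i * X \<omega> j) + e\<^sup>2 * (X \<omega> j * X \<omega> j))"
    by (auto simp: power2_eq_square algebra_simps)
  then have "(\<integral>\<omega>. (X \<omega> i + e * X \<omega> j)\<^sup>2 \<partial>Q) =
     (\<integral>\<omega>. X \<omega> i * X \<omega> i + 2 * e * (X \<omega> i * X \<omega> j) + e\<^sup>2 * (X \<omega> j * X \<omega> j) \<partial>Q)"
    by (simp only:)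
  also have "\<dots> = (\<integral>\<omega>. X \<omega> i * X \<omega> i \<partial>Q) + 2 * e * (\<integral>\<omega>. X \<omega> i * X \<omega> j \<partial>Q) + e\<^sup>2 * (\<integral>\<omega>. X \<omega> j * X \<omega> j \<partial>Q)"
    using c(1)[OF ij(1) ij(1)] c(1)[OF ij] c(1)[OF ij(2) ij(2)] by simp
  finally show ?thesis using c(2) ij by simp
qed

text \<open>Polarization: \<open>f k * g k\<close> is a quarter of the difference of \<open>(f k + g k)\<^sup>2\<close> and \<open>(f k - g k)\<^sup>2\<close>.\<close>

lemma sum_pair_square_deviation_imp:
  fixes f g :: "nat \<Rightarrow> real"
  assumes plus: "\<bar>(1 / real n) * (\<Sum>k=1..n. (f k + g k)\<^sup>2) - (a + 2 * c + b)\<bar> \<le> 2 * t"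
    and minus: "\<bar>(1 / real n) * (\<Sum>k=1..n. (f k - g k)\<^sup>2) - (a - 2 * c + b)\<bar> \<le> 2 * t"
  shows "\<bar>(1 / real n) * (\<Sum>k=1..n. f k * g k) - c\<bar> \<le> t"
proof -
  define u where "u = (1 / real n) * (\<Sum>k=1..n. (f k + g k)\<^sup>2)"
  define v where "v = (1 / real n) * (\<Sum>k=1..n. (f k - g k)\<^sup>2)"
  have "(\<Sum>k=1..n. f k * g k) = (1/4) * ((\<Sum>k=1..n. (f k + g k)\<^sup>2) - (\<Sum>k=1..n. (f k - g k)\<^sup>2))"
    unfolding sum_subtractf[symmetric] sum_distrib_left
    by (intro sum.cong refl) (simp add: power2_eq_square algebra_simps)
  then have "(1 / real n) * (\<Sum>k=1..n. f k * g k) = (1/4) * (u - v)"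
    unfolding u_def v_def by (simp only: right_diff_distrib mult.left_commute)
  moreover have "\<bar>(1/4) * (u - v) - c\<bar> \<le> t"
    using plus[folded u_def] minus[folded v_def] unfolding abs_le_iff by (simp add: field_simps)
  ultimately show ?thesis by (simp only:)
qed

context latent_gaussian_model
begin

lemma observed_component_measurable:
  assumes "k \<in> {1..n}" "i < p"
  shows "(\<lambda>\<omega>. XO k \<omega> i) \<in> borel_measurable P"
proof -
  interpret P: prob_space P by (rule prob_P)
  have "XO k \<in> measurable P (vec_space_borel p)"
    using indep assms(1) unfolding P.indep_vars_def by auto
  then show ?thesis
    using measurable_compose[OF _ measurable_component_singleton[of i "{..<p}" "\<lambda>_. borel"]] assms(2)
    by auto
qed

text \<open>The second moment of \<open>X i + e * X j\<close> is at most \<open>4 * b\<close>, since those of \<open>X i + X j\<close> and \<open>X i - X j\<close> are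
  nonnegative and add up to twice the sum of the two variances.\<close>

lemma observed_pair_square_deviation:
  assumes ij: "i < p" "j < p" and e: "e = 1 \<or> e = - 1"
    and diag: "\<And>i. i < p \<Longrightarrow> covariance_mat Q p X $$ (i, i) \<le> b"
    and b: "b > 0" and t: "0 \<le> t" "t \<le> 4 * b" and n: "n \<ge> 1"
  shows "measure P {\<omega> \<in> space P. \<bar>(1 / real n) * (\<Sum>k=1..n. (XO k \<omega> i + e * XO k \<omega> j)\<^sup>2)
      - (covariance_mat Q p X $$ (i, i) + 2 * e * covariance_mat Q p X $$ (i, j)
          + covariance_mat Q p X $$ (j, j))\<bar> > 2 * t}
    \<le> 2 * exp (- (real n * t\<^sup>2 / (64 * b\<^sup>2)))"
proof -
  interpret P: prob_space P by (rule prob_P)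
  have pd: "p \<le> p + r" by simp
  have d: "i < p + r" "j < p + r" using ij by auto
  let ?g = "\<lambda>x. x i + e * x j :: real"
  have "(\<lambda>x. x k) \<in> borel_measurable (vec_space_borel p)" if "k < p" for k
    using measurable_component_singleton[of k "{..<p}" "\<lambda>_. borel"] that by simp
  then have gm: "?g \<in> borel_measurable (vec_space_borel p)"
    using ij by (intro borel_measurable_add borel_measurable_times borel_measurable_const)
  have e2: "e\<^sup>2 = 1" using e by auto
  note mom = centered_gaussian_pair_second_moment[OF prob_Q gaussian pd ij]
  have "0 \<le> (\<integral>\<omega>. (X \<omega> i + (- e) * X \<omega> j)\<^sup>2 \<partial>Q)" by simp
  then have le: "(\<integral>\<omega>. (X \<omega> i + e * X \<omega> j)\<^sup>2 \<partial>Q) \<le> 4 * b"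
    unfolding mom using diag[OF ij(1)] diag[OF ij(2)] e2 by simp
  have rm: "(\<lambda>\<omega>. restrict (X \<omega>) {..<p}) \<in> measurable Q (vec_space_borel p)"
    using gaussian unfolding centered_gaussian_def
    by (intro measurable_compose[OF _ measurable_restrict_subset]) auto
  have dist: "distr P borel (\<lambda>\<omega>. ?g (XO k \<omega>)) = distr Q borel (\<lambda>\<omega>. X \<omega> i + e * X \<omega> j)"
    if k: "k \<in> {1..n}" for k
  proof -
    have km: "XO k \<in> measurable P (vec_space_borel p)"
      using indep k unfolding P.indep_vars_def by auto
    have "distr P borel (\<lambda>\<omega>. ?g (XO k \<omega>)) = distr (distr P (vec_space_borel p) (XO k)) borel ?g"
      using distr_distr[OF gm km] by (simp add: comp_def)
    also have "\<dots> = distr (distr Q (vec_space_borel p) (\<lambda>\<omega>. restrict (X \<omega>) {..<p})) borel ?g"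
      using copies[OF k] by (simp only:)
    also have "\<dots> = distr Q borel (\<lambda>\<omega>. X \<omega> i + e * X \<omega> j)"
      using distr_distr[OF gm rm] ij by (simp add: comp_def)
    finally show ?thesis .
  qed
  have ind: "P.indep_vars (\<lambda>_. borel) (\<lambda>k \<omega>. ?g (XO k \<omega>)) {1..n}"
    by (rule P.indep_vars_compose2[OF indep gm])
  have "measure P {\<omega> \<in> space P. \<bar>(1 / real n) * (\<Sum>k=1..n. (?g (XO k \<omega>))\<^sup>2)
      - (\<integral>\<omega>. (X \<omega> i + e * X \<omega> j)\<^sup>2 \<partial>Q)\<bar> > 2 * t}
    \<le> 2 * exp (- (real n * (2 * t)\<^sup>2 / (16 * (4 * b)\<^sup>2)))"
    using b t n
    by (intro P.iid_square_mean_deviation[OF prob_Q centered_gaussian_pair_normal[OF gaussian d] le _ _ _ _ ind dist])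
      auto
  then show ?thesis unfolding mom e2 by (simp add: power_mult_distrib)
qed

text \<open>A union bound over the \<open>p\<^sup>2\<close> pairs of coordinates and the two signs of polarization, each with two
  tails.\<close>

lemma sample_covariance_deviation:
  assumes diag: "\<And>i. i < p \<Longrightarrow> covariance_mat Q p X $$ (i, i) \<le> b"
    and b: "b > 0" and t: "0 \<le> t" "t \<le> 4 * b" and n: "n \<ge> 1"
  shows "\<exists>E \<in> sets P. measure P E \<ge> 1 - 4 * (real p)\<^sup>2 * exp (- (real n * t\<^sup>2 / (64 * b\<^sup>2))) \<and>
    (\<forall>\<omega>\<in>E. \<forall>i<p. \<forall>j<p. \<bar>sample_covariance n p (\<lambda>k. XO k \<omega>) $$ (i, j)
        - covariance_mat Q p X $$ (i, j)\<bar> \<le> t)"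
proof -
  interpret P: prob_space P by (rule prob_P)
  note XOm = observed_component_measurable
  define q where "q = exp (- (real n * t\<^sup>2 / (64 * b\<^sup>2)))"
  define G where "G = (\<lambda>(i, j, e). {\<omega> \<in> space P. \<bar>(1 / real n) * (\<Sum>k=1..n. (XO k \<omega> i + e * XO k \<omega> j)\<^sup>2)
      - (covariance_mat Q p X $$ (i, i) + 2 * e * covariance_mat Q p X $$ (i, j)
          + covariance_mat Q p X $$ (j, j))\<bar> > 2 * t})"
  define I where "I = {..<p} \<times> {..<p} \<times> {1, - 1 :: real}"
  have fin: "finite I" unfolding I_def by simp
  have cardI: "card I = 2 * p\<^sup>2" unfolding I_def by (simp add: power2_eq_square)
  have Gm: "G z \<in> sets P" if zI: "z \<in> I" for z
  proof -
    obtain i j e where z: "z = (i, j, e)" "i < p" "j < p" using zI unfolding I_def by (cases z) auto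
    have [measurable]: "\<And>k. k \<in> {1..n} \<Longrightarrow> (\<lambda>\<omega>. XO k \<omega> i) \<in> borel_measurable P"
      "\<And>k. k \<in> {1..n} \<Longrightarrow> (\<lambda>\<omega>. XO k \<omega> j) \<in> borel_measurable P"
      using z XOm by auto
    show ?thesis unfolding z G_def prod.case by measurable
  qed
  have Gp: "P.prob (G z) \<le> 2 * q" if zI: "z \<in> I" for z
  proof -
    obtain i j e where z: "z = (i, j, e)" "i < p" "j < p" "e = 1 \<or> e = - 1"
      using zI unfolding I_def by (cases z) auto
    show ?thesis unfolding z(1) G_def prod.case q_def
      by (rule observed_pair_square_deviation[OF z(2-4) diag b t n])
  qed
  have Um: "(\<Union>z\<in>I. G z) \<in> sets P" using fin Gm by auto
  have "P.prob (\<Union>z\<in>I. G z) \<le> (\<Sum>z\<in>I. P.prob (G z))"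
    using fin Gm by (intro P.finite_measure_subadditive_finite) auto
  also have "\<dots> \<le> (\<Sum>z\<in>I. 2 * q)" by (intro sum_mono Gp)
  also have "\<dots> = 4 * (real p)\<^sup>2 * q" by (simp add: cardI)
  finally have "1 - 4 * (real p)\<^sup>2 * q \<le> P.prob (space P - (\<Union>z\<in>I. G z))"
    using P.prob_compl[OF Um] by linarith
  moreover have "\<bar>sample_covariance n p (\<lambda>k. XO k \<omega>) $$ (i, j) - covariance_mat Q p X $$ (i, j)\<bar> \<le> t"
    if w: "\<omega> \<in> space P - (\<Union>z\<in>I. G z)" and ij: "i < p" "j < p" for \<omega> i j
  proof -
    have out: "\<bar>(1 / real n) * (\<Sum>k=1..n. (XO k \<omega> i + e * XO k \<omega> j)\<^sup>2)
      - (covariance_mat Q p X $$ (i, i) + 2 * e * covariance_mat Q p X $$ (i, j)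
          + covariance_mat Q p X $$ (j, j))\<bar> \<le> 2 * t" if "e = 1 \<or> e = - 1" for e
    proof -
      have "(i, j, e) \<in> I" using ij that unfolding I_def by auto
      then have "\<omega> \<notin> G (i, j, e)" using w by blast
      then show ?thesis using w unfolding G_def prod.case by (simp add: not_less)
    qed
    have "\<bar>(1 / real n) * (\<Sum>k=1..n. XO k \<omega> i * XO k \<omega> j) - covariance_mat Q p X $$ (i, j)\<bar> \<le> t"
      using out[of 1] out[of "- 1"] by (intro sum_pair_square_deviation_imp) auto
    then show ?thesis unfolding sample_covariance_def using ij by simp
  qed
  ultimately show ?thesis unfolding q_def using Um by (intro bexI[of _ "space P - (\<Union>z\<in>I. G z)"]) auto
qed

section \<open>The estimator in the latent variable model\<close>

text \<open>With the deviation \<open>t = 24 * M * sqrt (ln p / n)\<close> the exponent in the concentration bound is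
  \<open>9 * ln p\<close>, so the failure probability is at most \<open>4 * p\<^sup>2 / p ^ 9\<close>. The threshold \<open>48 * M\<close> on \<open>C\<^sub>1\<close> is the one
  that ensures \<open>2 * M\<^sub>p * t \<le> \<tau>\<close>, and the smallness of \<open>sqrt (ln p / n)\<close> keeps \<open>t\<close> in the range of the
  concentration bound. Membership in \<^const>\<open>carrier_mat\<close> is part of the event because the maximum norm
  of a difference does not reveal the dimensions of its first argument.\<close>

lemma latent_clime_error:
  fixes M\<^sub>p M :: real
  assumes M: "M > 0" and n: "n \<ge> 1"
    and Scl: "S \<in> sparse_class p s\<^sub>0 M\<^sub>p"
    and eig: "eigendecomposition p L r\<^sub>0 lam u"
    and L1: "l1_op_norm_mat L \<le> M\<^sub>p"
    and lmax: "lambda_max (covariance_mat Q p X) \<le> M"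
    and lmin: "lambda_min (covariance_mat Q p X) \<ge> 1 / M"
    and C\<^sub>1: "C\<^sub>1 > 48 * M"
    and \<tau>: "\<tau> = C\<^sub>1 * M\<^sub>p * sqrt (ln (real p) / real n)"
    and small: "sqrt (ln (real p) / real n) \<le> 1 / 6"
    and Linf: "max_norm_mat L \<le> M\<^sub>p * \<tau>"
    and sol: "\<And>\<omega>. \<omega> \<in> space P \<Longrightarrow> clime_solution p (sample_covariance n p (\<lambda>k. XO k \<omega>)) \<tau> (S1 \<omega>)"
  shows "with_prob_gt P (1 - 5 / real p ^ 6)
    (\<lambda>\<omega>. symmetrize (S1 \<omega>) \<in> carrier_mat p p \<and> max_norm_mat (symmetrize (S1 \<omega>) - S) \<le> 9 * M\<^sub>p * \<tau>)"
proof -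
  have p: "p > 0" using dim_pos by simp
  let ?Sg = "covariance_mat Q p X"
  have Sg: "?Sg \<in> carrier_mat p p" unfolding covariance_mat_def by simp
  have symSg: "transpose_mat ?Sg = ?Sg"
    unfolding covariance_mat_def by (intro eq_matI) (auto simp: mult.commute)
  have fin: "finite (spectrum ?Sg)" by (rule card_finite_spectrum(1)[OF Sg])
  have sp: "\<bar>x\<bar> \<le> M" if "x \<in> spectrum ?Sg" for x
  proof -
    have "x \<le> M" using Max_ge[OF fin that] lmax unfolding lambda_max_def by linarith
    moreover have "1 / M \<le> x" using Min_le[OF fin that] lmin unfolding lambda_min_def by linarith
    ultimately show ?thesis using M by (smt (verit) divide_pos_pos)
  qed
  have diag: "?Sg $$ (i, i) \<le> M" if "i < p" for i
    using symmetric_diag_entry_le_of_spectrum[OF Sg symSg that sp] by simp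
  have S: "S \<in> carrier_mat p p" and symS: "transpose_mat S = S" and S1op: "l1_op_norm_mat S \<le> M\<^sub>p"
    using Scl unfolding sparse_class_def sym_pos_def_def by auto
  have Leq: "L = mat p p (\<lambda>(a, b). \<Sum>i<r\<^sub>0. lam i * u i $ a * u i $ b)"
    using eig unfolding eigendecomposition_def by blast
  have Lc: "L \<in> carrier_mat p p" by (subst Leq) simp
  have Lij: "L $$ (i, j) = L $$ (j, i)" if "i < p" "j < p" for i j
  proof -
    have "L $$ (a, b) = (\<Sum>i<r\<^sub>0. lam i * u i $ a * u i $ b)" if "a < p" "b < p" for a b
      using that by (subst Leq) simp
    then show ?thesis using that by (simp add: mult_ac)
  qed
  have Sij: "S $$ (i, j) = S $$ (j, i)" if "i < p" "j < p" for i j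
    using arg_cong[OF symS, of "\<lambda>B. B $$ (j, i)"] that S by simp
  have Srow: "(\<Sum>j<p. \<bar>S $$ (i, j)\<bar>) \<le> M\<^sub>p" and Lrow: "(\<Sum>j<p. \<bar>L $$ (i, j)\<bar>) \<le> M\<^sub>p" if "i < p" for i
    using S1op L1 that unfolding l1_op_norm_mat_le_iff[OF S p] l1_op_norm_mat_le_iff[OF Lc p] by auto
  have Lent: "\<bar>L $$ (i, j)\<bar> \<le> M\<^sub>p * \<tau>" if "i < p" "j < p" for i j
    using Linf that unfolding max_norm_mat_le_iff[OF Lc p p] by blast
  have Mp: "0 \<le> M\<^sub>p" using order_trans[OF sum_nonneg Srow[OF p]] by simp
  define x where "x = sqrt (ln (real p) / real n)"
  have lnp: "0 \<le> ln (real p)" using p by simp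
  have x0: "0 \<le> x" unfolding x_def using lnp by simp
  have nx: "real n * x\<^sup>2 = ln (real p)" unfolding x_def using lnp n by simp
  define t where "t = 24 * M * x"
  have t: "0 \<le> t" "t \<le> 4 * M" using M x0 small unfolding t_def x_def by auto
  have texp: "real n * t\<^sup>2 / (64 * M\<^sup>2) = 9 * ln (real p)"
  proof -
    have "real n * t\<^sup>2 = 576 * M\<^sup>2 * (real n * x\<^sup>2)" unfolding t_def by (simp add: power_mult_distrib)
    then show ?thesis unfolding nx using M by simp
  qed
  have \<tau>0: "0 \<le> \<tau>" unfolding \<tau> using C\<^sub>1 M Mp x0[unfolded x_def] by (intro mult_nonneg_nonneg) auto
  have tm: "t * (2 * M\<^sub>p) \<le> \<tau>"
  proof -
    have "t * (2 * M\<^sub>p) = (48 * M) * (M\<^sub>p * x)" unfolding t_def by simp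
    also have "\<dots> \<le> C\<^sub>1 * (M\<^sub>p * x)" using C\<^sub>1 Mp x0 by (intro mult_right_mono) auto
    finally show ?thesis unfolding \<tau> x_def by (simp add: mult_ac)
  qed
  let ?Om = "S - L"
  have Om: "?Om \<in> carrier_mat p p" using Lc by (rule minus_carrier_mat)
  have Oment: "?Om $$ (i, j) = S $$ (i, j) - L $$ (i, j)" if "i < p" "j < p" for i j
    using that S Lc by simp
  have rows: "(\<Sum>k<p. \<bar>?Om $$ (i, k)\<bar>) \<le> 2 * M\<^sub>p" if "i < p" for i
  proof -
    have "(\<Sum>k<p. \<bar>?Om $$ (i, k)\<bar>) \<le> (\<Sum>k<p. \<bar>S $$ (i, k)\<bar> + \<bar>L $$ (i, k)\<bar>)"
      using that by (intro sum_mono) (auto simp: Oment simp del: index_minus_mat)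
    then show ?thesis using Srow[OF that] Lrow[OF that] by (simp add: sum.distrib)
  qed
  have symOm: "?Om $$ (i, j) = ?Om $$ (j, i)" if "i < p" "j < p" for i j
    using that Oment Sij Lij by metis
  have cols: "(\<Sum>k<p. \<bar>?Om $$ (k, j)\<bar>) \<le> 2 * M\<^sub>p" if "j < p" for j
  proof -
    have "(\<Sum>k<p. \<bar>?Om $$ (k, j)\<bar>) = (\<Sum>k<p. \<bar>?Om $$ (j, k)\<bar>)"
      using that by (intro sum.cong refl arg_cong[of _ _ abs] symOm) auto
    then show ?thesis using rows[OF that] by simp
  qed
  have inv: "?Sg * ?Om = 1\<^sub>m p" "?Om * ?Sg = 1\<^sub>m p"
    using inverse Sg Om unfolding inverts_mat_def by auto
  obtain E where E: "E \<in> sets P"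
    and Epr: "measure P E \<ge> 1 - 4 * (real p)\<^sup>2 * exp (- (real n * t\<^sup>2 / (64 * M\<^sup>2)))"
    and Edev: "\<And>\<omega> i j. \<omega> \<in> E \<Longrightarrow> i < p \<Longrightarrow> j < p \<Longrightarrow>
      \<bar>sample_covariance n p (\<lambda>k. XO k \<omega>) $$ (i, j) - ?Sg $$ (i, j)\<bar> \<le> t"
    using sample_covariance_deviation[OF diag M t n] by blast
  have "1 - 5 / real p ^ 6 < measure P E"
  proof -
    have "exp (- (9 * ln (real p))) = 1 / real p ^ 9"
      using p by (simp add: exp_minus exp_of_nat_mult[of 9, simplified] inverse_eq_divide)
    then have "4 * (real p)\<^sup>2 * exp (- (9 * ln (real p))) = 4 / real p ^ 7"
      using p by (simp add: field_simps power_add[symmetric])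
    also have "\<dots> \<le> 4 / real p ^ 6"
      using p by (intro divide_left_mono power_increasing) auto
    also have "\<dots> < 5 / real p ^ 6" using p by (intro divide_strict_right_mono) auto
    finally show ?thesis using Epr unfolding texp by linarith
  qed
  moreover have "symmetrize (S1 \<omega>) \<in> carrier_mat p p \<and>
      max_norm_mat (symmetrize (S1 \<omega>) - S) \<le> 9 * M\<^sub>p * \<tau>" if w: "\<omega> \<in> E" for \<omega>
  proof -
    have wP: "\<omega> \<in> space P" using w E sets.sets_into_space by blast
    have S1c: "S1 \<omega> \<in> carrier_mat p p" using sol[OF wP] unfolding clime_solution_def by blast
    have Sn: "sample_covariance n p (\<lambda>k. XO k \<omega>) \<in> carrier_mat p p"
      unfolding sample_covariance_def by simp
    have err: "\<bar>S1 \<omega> $$ (i, j) - ?Om $$ (i, j)\<bar> \<le> 2 * (2 * M\<^sub>p) * \<tau>" if ij: "i < p" "j < p" for i j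
      by (rule clime_entrywise_error[OF Sn Sg Om inv rows cols Edev[OF w] tm sol[OF wP] ij])
    have symc: "symmetrize (S1 \<omega>) \<in> carrier_mat p p"
      unfolding symmetrize_def using S1c by simp
    have dc: "symmetrize (S1 \<omega>) - S \<in> carrier_mat p p" using S by (rule minus_carrier_mat)
    have "\<bar>(symmetrize (S1 \<omega>) - S) $$ (i, j)\<bar> \<le> 9 * M\<^sub>p * \<tau>" if ij: "i < p" "j < p" for i j
    proof -
      have "symmetrize (S1 \<omega>) $$ (i, j) \<in> {S1 \<omega> $$ (i, j), S1 \<omega> $$ (j, i)}"
        unfolding symmetrize_def using ij S1c by (auto simp: Let_def min_def max_def)
      then have "\<bar>symmetrize (S1 \<omega>) $$ (i, j) - ?Om $$ (i, j)\<bar> \<le> 4 * (M\<^sub>p * \<tau>)"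
        using err[OF ij] err[OF ij(2,1)] symOm[OF ij] by auto
      then have "\<bar>symmetrize (S1 \<omega>) $$ (i, j) - S $$ (i, j)\<bar> \<le> 5 * (M\<^sub>p * \<tau>)"
        using Lent[OF ij] unfolding Oment[OF ij] by linarith
      moreover have "0 \<le> M\<^sub>p * \<tau>" using Mp \<tau>0 by simp
      ultimately show ?thesis using ij S symc by simp
    qed
    then show ?thesis using symc unfolding max_norm_mat_le_iff[OF dc p p] by blast
  qed
  ultimately show ?thesis unfolding with_prob_gt_def using E by blast
qed

end

text \<open>An estimate of a zero entry is at most \<open>b\<close> in magnitude and is cut off; an estimate of a nonzero
  entry exceeds \<open>b\<close> and cannot have changed sign.\<close>

lemma hard_threshold_sign_consistent:
  assumes A: "A \<in> carrier_mat p p" and S: "S \<in> carrier_mat p p" and p: "0 < p"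
    and err: "max_norm_mat (A - S) \<le> b" and gap: "min_nonzero_entry S > 2 * b"
  shows "sign_mat (hard_threshold b A) = sign_mat S"
proof -
  have dc: "A - S \<in> carrier_mat p p" using S by (rule minus_carrier_mat)
  have close: "\<bar>A $$ (i, j) - S $$ (i, j)\<bar> \<le> b" if "i < p" "j < p" for i j
    using err that A S unfolding max_norm_mat_le_iff[OF dc p p] by auto
  have big: "2 * b < \<bar>S $$ (i, j)\<bar>" if ij: "i < p" "j < p" and nz: "S $$ (i, j) \<noteq> 0" for i j
  proof -
    let ?N = "{\<bar>S $$ (i, j)\<bar> |i j. i < dim_row S \<and> j < dim_col S \<and> S $$ (i, j) \<noteq> 0}"
    have "?N \<subseteq> (\<lambda>(i, j). \<bar>S $$ (i, j)\<bar>) ` ({..<p} \<times> {..<p})" using S by auto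
    then have "finite ?N" by (rule finite_subset) simp
    moreover have "\<bar>S $$ (i, j)\<bar> \<in> ?N" using ij nz S by auto
    ultimately have "min_nonzero_entry S \<le> \<bar>S $$ (i, j)\<bar>"
      unfolding min_nonzero_entry_def by (rule Min_le)
    then show ?thesis using gap by linarith
  qed
  show ?thesis
  proof (rule eq_matI)
    fix i j assume "i < dim_row (sign_mat S)" "j < dim_col (sign_mat S)"
    then have ij: "i < p" "j < p" using S unfolding sign_mat_def by auto
    have "sgn (if \<bar>A $$ (i, j)\<bar> > b then A $$ (i, j) else 0) = sgn (S $$ (i, j))"
    proof (cases "S $$ (i, j) = 0")
      case True
      then show ?thesis using close[OF ij] by simp
    next
      case False
      then have "b < \<bar>A $$ (i, j)\<bar>" "(0 < A $$ (i, j)) = (0 < S $$ (i, j))"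
        using close[OF ij] big[OF ij] by linarith+
      then show ?thesis using False close[OF ij] unfolding sgn_real_def by auto
    qed
    then show "sign_mat (hard_threshold b A) $$ (i, j) = sign_mat S $$ (i, j)"
      using ij A S unfolding sign_mat_def hard_threshold_def by simp
  qed (use A S in \<open>auto simp: sign_mat_def hard_threshold_def\<close>)
qed

lemma with_prob_gt_mono:
  assumes "with_prob_gt P q A" and "\<And>\<omega>. \<omega> \<in> space P \<Longrightarrow> A \<omega> \<Longrightarrow> B \<omega>"
  shows "with_prob_gt P q B"
proof -
  obtain E where "E \<in> sets P" "\<forall>\<omega>\<in>E. A \<omega>" "measure P E > q"
    using assms(1) unfolding with_prob_gt_def by blast
  moreover have "\<forall>\<omega>\<in>E. B \<omega>"
    using calculation(2) assms(2) sets.sets_into_space[OF calculation(1)] by blast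
  ultimately show ?thesis unfolding with_prob_gt_def by blast
qed

section \<open>Rates and sign consistency\<close>

theorem theorem1:
  fixes M :: real
  assumes "M > 0"
  shows "\<exists>C\<^sub>0 C\<^sub>s :: real. \<forall>C\<^sub>1 > C\<^sub>0. \<exists>C :: real \<Rightarrow> real.
    \<forall>(p :: nat \<Rightarrow> nat) (r :: nat \<Rightarrow> nat) (s\<^sub>0 :: nat \<Rightarrow> nat) (r\<^sub>0 :: nat \<Rightarrow> nat)
      (M\<^sub>p :: nat \<Rightarrow> real) (c\<^sub>0 :: real) (\<tau> :: nat \<Rightarrow> real)
      (Q :: nat \<Rightarrow> 'v measure) (P :: nat \<Rightarrow> 'w measure)
      (X :: nat \<Rightarrow> 'v \<Rightarrow> nat \<Rightarrow> real) (XO :: nat \<Rightarrow> nat \<Rightarrow> 'w \<Rightarrow> nat \<Rightarrow> real)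
      (S :: nat \<Rightarrow> real mat) (L :: nat \<Rightarrow> real mat)
      (lam :: nat \<Rightarrow> nat \<Rightarrow> real) (u :: nat \<Rightarrow> nat \<Rightarrow> real vec)
      (S1 :: nat \<Rightarrow> 'w \<Rightarrow> real mat) (Shat :: nat \<Rightarrow> 'w \<Rightarrow> real mat)
      (Stilde :: nat \<Rightarrow> 'w \<Rightarrow> real mat).
      (\<forall>n\<ge>1.
         latent_gaussian_model (Q n) (P n) n (p n) (r n) (X n) (XO n) (S n) (L n) \<and>
         S n \<in> sparse_class (p n) (s\<^sub>0 n) (M\<^sub>p n) \<and>
         vec_space.rank (p n) (L n) = r\<^sub>0 n \<and>
         eigendecomposition (p n) (L n) (r\<^sub>0 n) (lam n) (u n) \<and>
         (\<forall>i<r\<^sub>0 n. max_norm_vec (u n i) \<le> sqrt (c\<^sub>0 / real (p n))) \<and>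
         l1_op_norm_mat (L n) \<le> M\<^sub>p n \<and>
         lambda_max (covariance_mat (Q n) (p n) (X n)) \<le> M \<and>
         lambda_min (covariance_mat (Q n) (p n) (X n)) \<ge> 1 / M \<and>
         \<tau> n = C\<^sub>1 * M\<^sub>p n * sqrt (ln (real (p n)) / real n) \<and>
         max_norm_mat (L n) \<le> M\<^sub>p n * \<tau> n \<and>
         (\<forall>\<omega> \<in> space (P n).
            clime_solution (p n) (sample_covariance n (p n) (\<lambda>k. XO n k \<omega>)) (\<tau> n) (S1 n \<omega>) \<and>
            Shat n \<omega> = symmetrize (S1 n \<omega>) \<and>
            Stilde n \<omega> = hard_threshold (9 * M\<^sub>p n * \<tau> n) (Shat n \<omega>))) \<and>
      (\<lambda>n. sqrt (ln (real (p n)) / real n)) \<longlonglongrightarrow> 0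
      \<longrightarrow>
      (\<forall>\<^sub>F n in sequentially.
         with_prob_gt (P n) (1 - C\<^sub>s / real (p n) ^ 6)
           (\<lambda>\<omega>. max_norm_mat (Shat n \<omega> - S n) \<le> 9 * M\<^sub>p n * \<tau> n)) \<and>
      (\<forall>\<^sub>F n in sequentially.
         min_nonzero_entry (S n) > 18 * M\<^sub>p n * \<tau> n \<longrightarrow>
         with_prob_gt (P n) (1 - C\<^sub>s / real (p n) ^ 6)
           (\<lambda>\<omega>. sign_mat (Stilde n \<omega>) = sign_mat (S n))) \<and>
      (\<forall>B. (\<forall>n\<ge>1. M\<^sub>p n \<le> B) \<longrightarrow>
         (\<forall>\<^sub>F n in sequentially.
            min_nonzero_entry (S n) > C B * sqrt (ln (real (p n)) / real n) \<longrightarrow>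
            with_prob_gt (P n) (1 - C\<^sub>s / real (p n) ^ 6)
              (\<lambda>\<omega>. sign_mat (Stilde n \<omega>) = sign_mat (S n))))"
proof -
  have main: "(\<forall>\<^sub>F n in sequentially.
         with_prob_gt (P n) (1 - 5 / real (p n) ^ 6)
           (\<lambda>\<omega>. max_norm_mat (Shat n \<omega> - S n) \<le> 9 * M\<^sub>p n * \<tau> n)) \<and>
      (\<forall>\<^sub>F n in sequentially.
         min_nonzero_entry (S n) > 18 * M\<^sub>p n * \<tau> n \<longrightarrow>
         with_prob_gt (P n) (1 - 5 / real (p n) ^ 6)
           (\<lambda>\<omega>. sign_mat (Stilde n \<omega>) = sign_mat (S n))) \<and>
      (\<forall>B. (\<forall>n\<ge>1. M\<^sub>p n \<le> B) \<longrightarrow>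
         (\<forall>\<^sub>F n in sequentially.
            min_nonzero_entry (S n) > (18 * C\<^sub>1 * B\<^sup>2) * sqrt (ln (real (p n)) / real n) \<longrightarrow>
            with_prob_gt (P n) (1 - 5 / real (p n) ^ 6)
              (\<lambda>\<omega>. sign_mat (Stilde n \<omega>) = sign_mat (S n))))"
    if C1: "C\<^sub>1 > 48 * M"
      and model: "\<forall>n\<ge>1.
         latent_gaussian_model (Q n) (P n) n (p n) (r n) (X n) (XO n) (S n) (L n) \<and>
         S n \<in> sparse_class (p n) (s\<^sub>0 n) (M\<^sub>p n) \<and>
         vec_space.rank (p n) (L n) = r\<^sub>0 n \<and>
         eigendecomposition (p n) (L n) (r\<^sub>0 n) (lam n) (u n) \<and>
         (\<forall>i<r\<^sub>0 n. max_norm_vec (u n i) \<le> sqrt (c\<^sub>0 / real (p n))) \<and>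
         l1_op_norm_mat (L n) \<le> M\<^sub>p n \<and>
         lambda_max (covariance_mat (Q n) (p n) (X n)) \<le> M \<and>
         lambda_min (covariance_mat (Q n) (p n) (X n)) \<ge> 1 / M \<and>
         \<tau> n = C\<^sub>1 * M\<^sub>p n * sqrt (ln (real (p n)) / real n) \<and>
         max_norm_mat (L n) \<le> M\<^sub>p n * \<tau> n \<and>
         (\<forall>\<omega> \<in> space (P n).
            clime_solution (p n) (sample_covariance n (p n) (\<lambda>k. XO n k \<omega>)) (\<tau> n) (S1 n \<omega>) \<and>
            Shat n \<omega> = symmetrize (S1 n \<omega>) \<and>
            Stilde n \<omega> = hard_threshold (9 * M\<^sub>p n * \<tau> n) (Shat n \<omega>))"
      and lim: "(\<lambda>n. sqrt (ln (real (p n)) / real n)) \<longlonglongrightarrow> 0"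
    for C\<^sub>1 :: real and p r s\<^sub>0 r\<^sub>0 :: "nat \<Rightarrow> nat" and M\<^sub>p :: "nat \<Rightarrow> real" and c\<^sub>0 :: real
      and \<tau> :: "nat \<Rightarrow> real" and Q :: "nat \<Rightarrow> 'v measure" and P :: "nat \<Rightarrow> 'w measure"
      and X :: "nat \<Rightarrow> 'v \<Rightarrow> nat \<Rightarrow> real" and XO :: "nat \<Rightarrow> nat \<Rightarrow> 'w \<Rightarrow> nat \<Rightarrow> real"
      and S L :: "nat \<Rightarrow> real mat" and lam :: "nat \<Rightarrow> nat \<Rightarrow> real" and u :: "nat \<Rightarrow> nat \<Rightarrow> real vec"
      and S1 Shat Stilde :: "nat \<Rightarrow> 'w \<Rightarrow> real mat"
  proof -
    have m: "latent_gaussian_model (Q n) (P n) n (p n) (r n) (X n) (XO n) (S n) (L n)"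
        "S n \<in> sparse_class (p n) (s\<^sub>0 n) (M\<^sub>p n)"
        "eigendecomposition (p n) (L n) (r\<^sub>0 n) (lam n) (u n)"
        "l1_op_norm_mat (L n) \<le> M\<^sub>p n"
        "lambda_max (covariance_mat (Q n) (p n) (X n)) \<le> M"
        "lambda_min (covariance_mat (Q n) (p n) (X n)) \<ge> 1 / M"
        "\<tau> n = C\<^sub>1 * M\<^sub>p n * sqrt (ln (real (p n)) / real n)"
        "max_norm_mat (L n) \<le> M\<^sub>p n * \<tau> n"
      and data: "\<forall>\<omega> \<in> space (P n).
            clime_solution (p n) (sample_covariance n (p n) (\<lambda>k. XO n k \<omega>)) (\<tau> n) (S1 n \<omega>) \<and>
            Shat n \<omega> = symmetrize (S1 n \<omega>) \<and>
            Stilde n \<omega> = hard_threshold (9 * M\<^sub>p n * \<tau> n) (Shat n \<omega>)"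
      if "n \<ge> 1" for n
      using model[rule_format, OF that] by - (elim conjE, assumption)+
    have p: "0 < p n" and S: "S n \<in> carrier_mat (p n) (p n)"
      and op: "l1_op_norm_mat (S n) \<le> M\<^sub>p n" if n: "n \<ge> 1" for n
      using latent_gaussian_model.dim_pos[OF m(1)[OF n]] m(2)[OF n]
      unfolding sparse_class_def sym_pos_def_def by auto
    \<comment> \<open>The only use of the limit: \<open>n\<close> is large once the rate is at most \<open>1 / 6\<close>.\<close>
    have "\<forall>\<^sub>F n in sequentially. sqrt (ln (real (p n)) / real n) < 1 / 6"
      using order_tendstoD(2)[OF lim, of "1 / 6"] by simp
    then have ev: "\<forall>\<^sub>F n in sequentially. n \<ge> 1 \<and> sqrt (ln (real (p n)) / real n) \<le> 1 / 6"
      using eventually_ge_at_top[of 1] by eventually_elim simp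
    have error: "with_prob_gt (P n) (1 - 5 / real (p n) ^ 6)
        (\<lambda>\<omega>. Shat n \<omega> \<in> carrier_mat (p n) (p n) \<and>
             max_norm_mat (Shat n \<omega> - S n) \<le> 9 * M\<^sub>p n * \<tau> n)"
      if n: "n \<ge> 1 \<and> sqrt (ln (real (p n)) / real n) \<le> 1 / 6" for n
    proof -
      have n1: "n \<ge> 1" and small: "sqrt (ln (real (p n)) / real n) \<le> 1 / 6" using n by auto
      have sol: "clime_solution (p n) (sample_covariance n (p n) (\<lambda>k. XO n k \<omega>)) (\<tau> n) (S1 n \<omega>)"
        if "\<omega> \<in> space (P n)" for \<omega>
        using bspec[OF data[OF n1] that] by (elim conjE)
      have shat: "Shat n \<omega> = symmetrize (S1 n \<omega>)" if "\<omega> \<in> space (P n)" for \<omega>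
        using bspec[OF data[OF n1] that] by (elim conjE)
      show ?thesis
        using latent_gaussian_model.latent_clime_error[OF m(1)[OF n1] assms n1 m(2-6)[OF n1] C1
            m(7)[OF n1] small m(8)[OF n1] sol]
      proof (rule with_prob_gt_mono)
        fix \<omega> assume "\<omega> \<in> space (P n)"
          and "symmetrize (S1 n \<omega>) \<in> carrier_mat (p n) (p n) \<and>
            max_norm_mat (symmetrize (S1 n \<omega>) - S n) \<le> 9 * M\<^sub>p n * \<tau> n"
        then show "Shat n \<omega> \<in> carrier_mat (p n) (p n) \<and>
            max_norm_mat (Shat n \<omega> - S n) \<le> 9 * M\<^sub>p n * \<tau> n"
          unfolding shat[OF \<open>\<omega> \<in> space (P n)\<close>] by blast
      qed
    qed
    have sign: "with_prob_gt (P n) (1 - 5 / real (p n) ^ 6)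
        (\<lambda>\<omega>. sign_mat (Stilde n \<omega>) = sign_mat (S n))"
      if n: "n \<ge> 1 \<and> sqrt (ln (real (p n)) / real n) \<le> 1 / 6"
        and gap: "min_nonzero_entry (S n) > 18 * M\<^sub>p n * \<tau> n" for n
      using error[OF n]
    proof (rule with_prob_gt_mono)
      fix \<omega> assume w: "\<omega> \<in> space (P n)" and
        e: "Shat n \<omega> \<in> carrier_mat (p n) (p n) \<and> max_norm_mat (Shat n \<omega> - S n) \<le> 9 * M\<^sub>p n * \<tau> n"
      have n1: "n \<ge> 1" using n by simp
      have "Stilde n \<omega> = hard_threshold (9 * M\<^sub>p n * \<tau> n) (Shat n \<omega>)"
        using bspec[OF data[OF n1] w] by (elim conjE)
      then show "sign_mat (Stilde n \<omega>) = sign_mat (S n)"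
        using hard_threshold_sign_consistent[OF conjunct1[OF e] S p conjunct2[OF e]] n gap by simp
    qed
    \<comment> \<open>The witness \<open>18 * C\<^sub>1 * B\<^sup>2\<close> for \<open>C B\<close> comes from \<open>18 * M\<^sub>p * \<tau> = 18 * C\<^sub>1 * M\<^sub>p\<^sup>2 * sqrt (ln p / n)\<close>.\<close>
    have bounded: "18 * M\<^sub>p n * \<tau> n \<le> 18 * C\<^sub>1 * B\<^sup>2 * sqrt (ln (real (p n)) / real n)"
      if n: "n \<ge> 1" and B: "\<forall>n\<ge>1. M\<^sub>p n \<le> B" for n B
    proof -
      have "(\<Sum>j<p n. \<bar>S n $$ (0, j)\<bar>) \<le> M\<^sub>p n"
        using op[OF n] p[OF n] unfolding l1_op_norm_mat_le_iff[OF S[OF n] p[OF n]] by blast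
      then have "0 \<le> M\<^sub>p n" by (rule order_trans[OF sum_nonneg, rotated]) simp
      then have "(M\<^sub>p n)\<^sup>2 \<le> B\<^sup>2" using B n by (intro power_mono) auto
      then have "(18 * C\<^sub>1 * sqrt (ln (real (p n)) / real n)) * (M\<^sub>p n)\<^sup>2
          \<le> (18 * C\<^sub>1 * sqrt (ln (real (p n)) / real n)) * B\<^sup>2"
        using C1 assms p[OF n] by (intro mult_left_mono mult_nonneg_nonneg) auto
      then show ?thesis unfolding m(7)[OF n] by (simp add: power2_eq_square mult_ac)
    qed
    show ?thesis
    proof (intro conjI allI impI)
      show "\<forall>\<^sub>F n in sequentially. with_prob_gt (P n) (1 - 5 / real (p n) ^ 6)
          (\<lambda>\<omega>. max_norm_mat (Shat n \<omega> - S n) \<le> 9 * M\<^sub>p n * \<tau> n)"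
        using ev by (rule eventually_mono) (rule with_prob_gt_mono[OF error]; simp)
      show "\<forall>\<^sub>F n in sequentially. min_nonzero_entry (S n) > 18 * M\<^sub>p n * \<tau> n \<longrightarrow>
          with_prob_gt (P n) (1 - 5 / real (p n) ^ 6) (\<lambda>\<omega>. sign_mat (Stilde n \<omega>) = sign_mat (S n))"
        using ev by (rule eventually_mono) (intro impI sign)
      fix B assume B: "\<forall>n\<ge>1. M\<^sub>p n \<le> B"
      show "\<forall>\<^sub>F n in sequentially.
          min_nonzero_entry (S n) > (18 * C\<^sub>1 * B\<^sup>2) * sqrt (ln (real (p n)) / real n) \<longrightarrow>
          with_prob_gt (P n) (1 - 5 / real (p n) ^ 6) (\<lambda>\<omega>. sign_mat (Stilde n \<omega>) = sign_mat (S n))"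
        using ev by (rule eventually_mono) (intro impI sign, assumption, metis B bounded le_less_trans)
    qed
  qed
  show ?thesis
    apply (rule exI[of _ "48 * M"], rule exI[of _ 5], intro allI impI)
    subgoal premises C1 for C\<^sub>1
      by (rule exI[of _ "\<lambda>B. 18 * C\<^sub>1 * B\<^sup>2"], intro allI impI, rule main[OF C1],
          erule conjunct1, erule conjunct2)
    done
qed

end
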